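(* There exists a metric, strictly ergodic, distal flow $(W,T)$ whose enveloping group $E(W,T)$ is not strictly ergodic (as a $T$-flow).
   Context: A flow $(X,T)$ is a compact Hausdorff space $X$ with a self-homeomorphism $T$; it is minimal if every orbit is dense, and strictly ergodic if it is minimal and has exactly one $T$-invariant (regular) Borel probability measure. A flow is metric if $X$ is metrizable; a metric flow is distal if $x\neq y$ implies $\inf_{n\in\mathbb{Z}}d(T^nx,T^ny)>0$. The enveloping semigroup $E(W,T)$ is the closure of $\{T^n:n\in\mathbb{Z}\}$ in $W^W$ with the product topology; it is a compact semigroup under composition, which is a group when $(W,T)$ is distal (then called the enveloping group), and it is a flow under left multiplication $p\mapsto T\circ p$. *)

theory Defs
  imports "HOL-Analysis.Analysis" "HOL-Probability.Probability_Measure"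
begin

text \<open>Spaces are abstract topologies, whose carrier may be any subset of the type. Every compact
  metrizable space embeds in the Hilbert cube, so topologies on \<^typ>\<open>nat \<Rightarrow> complex\<close>
  represent all compact metrizable spaces up to homeomorphism.\<close>

definition flow :: "'a topology \<Rightarrow> ('a \<Rightarrow> 'a) \<Rightarrow> bool" where
  "flow X T \<longleftrightarrow> compact_space X \<and> Hausdorff_space X \<and> homeomorphic_map X X T"

text \<open>The predicates below are meant for flows; that the pair is a flow is always stated
  separately, so that a negated predicate never holds merely because the pair is not a flow.\<close>

definition flow_pow :: "'a topology \<Rightarrow> ('a \<Rightarrow> 'a) \<Rightarrow> int \<Rightarrow> 'a \<Rightarrow> 'a" where
  "flow_pow X T n =
     (if 0 \<le> n then T ^^ nat n else inv_into (topspace X) T ^^ nat (- n))"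

definition minimal_flow :: "'a topology \<Rightarrow> ('a \<Rightarrow> 'a) \<Rightarrow> bool" where
  "minimal_flow X T \<longleftrightarrow>
     (\<forall>x\<in>topspace X. X closure_of (range (\<lambda>n. flow_pow X T n x)) = topspace X)"

definition borel_of :: "'a topology \<Rightarrow> 'a measure" where
  "borel_of X = sigma (topspace X) {U. openin X U}"

definition regular_borel_prob :: "'a topology \<Rightarrow> 'a measure \<Rightarrow> bool" where
  "regular_borel_prob X \<mu> \<longleftrightarrow>
     prob_space \<mu> \<and> sets \<mu> = sets (borel_of X) \<and>
     (\<forall>A\<in>sets \<mu>.
        emeasure \<mu> A = (INF U\<in>{U. openin X U \<and> A \<subseteq> U}. emeasure \<mu> U) \<and>
        emeasure \<mu> A = (SUP K\<in>{K. compactin X K \<and> K \<subseteq> A}. emeasure \<mu> K))"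

definition strictly_ergodic :: "'a topology \<Rightarrow> ('a \<Rightarrow> 'a) \<Rightarrow> bool" where
  "strictly_ergodic X T \<longleftrightarrow>
     minimal_flow X T \<and> (\<exists>!\<mu>. regular_borel_prob X \<mu> \<and> distr \<mu> \<mu> T = \<mu>)"

text \<open>On a compact space the condition does not depend on the choice of the metric
  inducing the topology.\<close>

definition distal_flow :: "'a topology \<Rightarrow> ('a \<Rightarrow> 'a) \<Rightarrow> bool" where
  "distal_flow X T \<longleftrightarrow>
     (\<exists>d. Metric_space (topspace X) d \<and> Metric_space.mtopology (topspace X) d = X \<and>
        (\<forall>x\<in>topspace X. \<forall>y\<in>topspace X. x \<noteq> y \<longrightarrow>
           (INF n. d (flow_pow X T n x) (flow_pow X T n y)) > 0))"

text \<open>Self-maps of the space \<open>X\<close> are represented by extensional functions on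
  \<^term>\<open>topspace X\<close>, the points of the product topology; hence the restrictions.\<close>

definition enveloping :: "'a topology \<Rightarrow> ('a \<Rightarrow> 'a) \<Rightarrow> ('a \<Rightarrow> 'a) topology" where
  "enveloping X T =
     (let P = product_topology (\<lambda>_. X) (topspace X)
      in subtopology P (P closure_of (range (\<lambda>n. restrict (flow_pow X T n) (topspace X)))))"

definition enveloping_map :: "'a topology \<Rightarrow> ('a \<Rightarrow> 'a) \<Rightarrow> ('a \<Rightarrow> 'a) \<Rightarrow> ('a \<Rightarrow> 'a)" where
  "enveloping_map X T = (\<lambda>p. compose (topspace X) T p)"

end

theory Submission
  imports Defs
begin

text \<open>The flow is a skew product. Let \<open>X\<close> be the odometer, the inverse limit of the groups of
  roots of unity of order \<open>period k\<close>, with translation by the generator \<open>(zeta k)\<^sub>k\<close>; let \<open>t\<close> be a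
  point of the circle, rotated by a number \<open>rot\<close> that is not a root of unity; and let the fibre
  coordinate \<open>y\<close> on the circle be multiplied by \<open>t * cis (2 * pi * theta x)\<close>, where \<open>theta\<close> is
  a continuous real function on \<open>X\<close>. All coordinates are unit complex numbers, stored as \<open>w 0 = y\<close>,
  \<open>w 1 = t\<close>, \<open>w (k + 2) = x\<^sub>k\<close>.

  Such a flow is distal, since for two different points the distance in a suitable coordinate never
  changes. It is uniquely ergodic whatever \<open>theta\<close> is: for a monomial \<open>F\<close> with nonzero degree in
  \<open>y\<close>, the product of \<open>F \<circ> T\<^sup>h\<close> with the conjugate of \<open>F\<close> is a function of \<open>x\<close> times a nonzero
  power of \<open>t\<close>, so its integral vanishes for every invariant measure. Hence the functions
  \<open>F \<circ> T\<^sup>h\<close> are orthonormal, and having the same integral they have integral \<open>0\<close>. So the integrals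
  of all monomials are those of Haar measure on \<open>X \<times> circle \<times> circle\<close>, and by the
  Stone-Weierstrass theorem there is only one invariant measure; being invariant under the
  translations of this compact group, it charges every open set, which yields minimality
  (\<open>integral_monomial\<close>, \<open>carrier_measure_eqI\<close>, \<open>full_support\<close>).

  The enveloping semigroup \<open>E\<close> sees two points at once. For two points with \<open>y = t = 1\<close> and
  different \<open>x\<close> the factor \<open>t\<close> cancels, and the ratio of the two fibre coordinates at time \<open>n\<close> is
  \<open>cis (2 * pi * D n)\<close>, where \<open>D\<close> is a sum of differences of bump functions, one for each level of
  the odometer. The bumps have height \<open>1/2\<close> and are nonzero on sets of summably small density, and
  the bump of level \<open>k\<close> stays constant for a long time compared with the lower periods. Therefore the
  ratio is \<open>1\<close> for at least \<open>7/8\<close> of the times in an initial segment, but \<open>-1\<close> for at least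
  \<open>7/8\<close> of the times in long intervals starting at the top of a bump. Limits of averages along these
  two families of intervals give two different invariant measures on \<open>E\<close>
  (\<open>card_fibre_ratio_1\<close>, \<open>card_fibre_ratio_minus_1\<close>, \<open>enveloping_measure\<close>).

  As \<open>E\<close> is not metrizable, the passage from averages to regular Borel measures is made for
  arbitrary compact Hausdorff spaces: a shift-invariant finitely additive mean on the time axis
  induces a content on closed sets, and the content a measure
  (\<open>invariant_measure_of_orbit_mean\<close>).\<close>

section \<open>Invariant means on the natural numbers\<close>

definition invariant_mean :: "(nat set \<Rightarrow> real) \<Rightarrow> bool" where
  "invariant_mean m \<longleftrightarrow>
     (\<forall>A. 0 \<le> m A) \<and> m UNIV = 1 \<and> (\<forall>A B. A \<inter> B = {} \<longrightarrow> m (A \<union> B) = m A + m B) \<and>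
     (\<forall>A. m (Suc -` A) = m A)"

text \<open>Shifting a set changes the count in an interval only at the two ends; this is what makes limits
  of averages over long intervals shift-invariant.\<close>

lemma card_Suc_vimage_Int_interval:
  "\<bar>real (card (Suc -` A \<inter> {a..<a+L})) - real (card (A \<inter> {a..<a+L}))\<bar> \<le> 1"
proof -
  have 1: "card (Suc -` A \<inter> {a..<a+L}) = card (A \<inter> {Suc a..<Suc a+L})"
  proof (rule bij_betw_same_card)
    show "bij_betw Suc (Suc -` A \<inter> {a..<a+L}) (A \<inter> {Suc a..<Suc a+L})"
      by (rule bij_betwI[of _ _ _ "\<lambda>n. n - 1"]) auto
  qed
  have "A \<inter> {Suc a..<Suc a+L} \<subseteq> insert (a+L) (A \<inter> {a..<a+L})"
       "A \<inter> {a..<a+L} \<subseteq> insert a (A \<inter> {Suc a..<Suc a+L})" by auto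
  then have "card (A \<inter> {Suc a..<Suc a+L}) \<le> card (insert (a+L) (A \<inter> {a..<a+L}))"
       "card (A \<inter> {a..<a+L}) \<le> card (insert a (A \<inter> {Suc a..<Suc a+L}))"
    by (intro card_mono; simp)+
  moreover have "card (insert (a+L) (A \<inter> {a..<a+L})) \<le> Suc (card (A \<inter> {a..<a+L}))"
       "card (insert a (A \<inter> {Suc a..<Suc a+L})) \<le> Suc (card (A \<inter> {Suc a..<Suc a+L}))"
    by (auto simp: card_insert_if)
  ultimately show ?thesis using 1 by linarith
qed

text \<open>The averages over the given intervals form a sequence in the product of copies of the unit
  interval, one for each set of naturals. By compactness the sequence has a cluster point, and
  finite additivity, invariance and lower bounds, each of which concerns only finitely many sets,
  pass to it.\<close>

lemma invariant_mean_of_intervals: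
  fixes a L :: "nat \<Rightarrow> nat"
  assumes L: "filterlim L at_top sequentially"
  obtains m where "invariant_mean m"
    "\<And>A c. (\<And>j. c * real (L j) \<le> real (card (A \<inter> {a j..<a j + L j}))) \<Longrightarrow> c \<le> m A"
proof -
  define F where "F j A = real (card (A \<inter> {a j..<a j + L j})) / real (L j)" for j A
  define X :: "(nat set \<Rightarrow> real) set" where "X = PiE UNIV (\<lambda>_. {0..1})"
  have "compactin (product_topology (\<lambda>_::nat set. euclidean) UNIV) X"
    unfolding X_def compactin_PiE by auto
  then have "compact X" by (simp add: euclidean_product_topology)
  have F_X: "F j \<in> X" for j
  proof -
    have "card (A \<inter> {a j..<a j + L j}) \<le> L j" for A
      using card_mono[of "{a j..<a j + L j}" "A \<inter> {a j..<a j + L j}"] by simp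
    then show ?thesis by (auto simp: X_def F_def divide_le_eq)
  qed
  have "filtermap F sequentially \<noteq> bot"
    by (simp add: filtermap_bot_iff)
  moreover have "eventually (\<lambda>f. f \<in> X) (filtermap F sequentially)"
    by (simp add: eventually_filtermap F_X)
  ultimately obtain m where m: "inf (nhds m) (filtermap F sequentially) \<noteq> bot"
    using \<open>compact X\<close> unfolding compact_filter by blast
  \<comment> \<open>A filter finer than \<open>sequentially\<close> along which the averages converge to the cluster point.\<close>
  define H where "H = inf (filtercomap F (nhds m)) sequentially"
  have "H \<noteq> bot"
  proof
    assume "H = bot"
    then obtain P Q where PQ: "eventually P (filtercomap F (nhds m))" "eventually Q sequentially"
      "\<And>x. P x \<Longrightarrow> Q x \<Longrightarrow> False"
      unfolding H_def trivial_limit_def eventually_inf by blast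
    then obtain R where "eventually R (nhds m)" "\<And>x. R (F x) \<Longrightarrow> P x"
      by (auto simp: eventually_filtercomap)
    moreover have "eventually (\<lambda>f. \<exists>x. f = F x \<and> Q x) (filtermap F sequentially)"
      using PQ(2) by (auto simp: eventually_filtermap elim: eventually_mono)
    ultimately have "eventually (\<lambda>_. False) (inf (nhds m) (filtermap F sequentially))"
      unfolding eventually_inf using PQ(3) by blast
    with m show False by (simp add: trivial_limit_def)
  qed
  have "filterlim F (nhds m) H"
    unfolding H_def filterlim_def
    by (metis filtermap_filtercomap filtermap_mono inf.coboundedI1 inf_le1 order_trans)
  then have lim: "((\<lambda>j. F j A) \<longlongrightarrow> m A) H" for A
    by (rule continuous_on_tendsto_compose[OF continuous_on_product_coordinates[of A]]) auto
  have Hseq: "H \<le> sequentially" by (simp add: H_def)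
  have Lpos: "eventually (\<lambda>j. 0 < L j) sequentially"
    by (rule eventually_compose_filterlim[OF eventually_gt_at_top L])
  show ?thesis
  proof (rule that)
    show "invariant_mean m"
      unfolding invariant_mean_def
    proof (intro conjI allI impI)
      show "0 \<le> m A" for A
        by (rule tendsto_lowerbound[OF lim _ \<open>H \<noteq> bot\<close>]) (simp add: F_def)
      have "eventually (\<lambda>j. F j UNIV = 1) sequentially"
        using Lpos by eventually_elim (simp add: F_def)
      then have "((\<lambda>j. F j UNIV) \<longlongrightarrow> 1) H"
        by (intro tendsto_eventually filter_leD[OF Hseq])
      then show "m UNIV = 1" using lim tendsto_unique[OF \<open>H \<noteq> bot\<close>] by blast
    next
      fix A B :: "nat set" assume AB: "A \<inter> B = {}"
      have "F j (A \<union> B) = F j A + F j B" for j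
        using AB by (auto simp: F_def Int_Un_distrib2 add_divide_distrib[symmetric]
            intro!: arg_cong2[where f="(/)"] simp flip: of_nat_add intro!: card_Un_disjoint)
      then have "((\<lambda>j. F j (A \<union> B)) \<longlongrightarrow> m A + m B) H"
        using tendsto_add[OF lim[of A] lim[of B]] by simp
      then show "m (A \<union> B) = m A + m B" using lim tendsto_unique[OF \<open>H \<noteq> bot\<close>] by blast
    next
      fix A :: "nat set"
      have "((\<lambda>j. F j (Suc -` A) - F j A) \<longlongrightarrow> 0) sequentially"
      proof (rule Lim_null_comparison)
        show "\<forall>\<^sub>F j in sequentially. norm (F j (Suc -` A) - F j A) \<le> inverse (real (L j))"
        proof (rule always_eventually, rule allI)
          fix j
          have "norm (F j (Suc -` A) - F j A) = \<bar>real (card (Suc -` A \<inter> {a j..<a j+L j})) - real (card (A \<inter> {a j..<a j+L j}))\<bar> / real (L j)"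
            by (simp add: F_def flip: diff_divide_distrib)
          also have "\<dots> \<le> 1 / real (L j)"
            by (intro divide_right_mono card_Suc_vimage_Int_interval) simp
          finally show "norm (F j (Suc -` A) - F j A) \<le> inverse (real (L j))"
            by (simp add: inverse_eq_divide)
        qed
        show "((\<lambda>j. inverse (real (L j))) \<longlongrightarrow> 0) sequentially"
          by (intro tendsto_inverse_0_at_top filterlim_compose[OF filterlim_real_sequentially L])
      qed
      then have "((\<lambda>j. F j (Suc -` A) - F j A) \<longlongrightarrow> 0) H"
        using Hseq by (meson filterlim_mono order_refl)
      moreover have "((\<lambda>j. F j (Suc -` A) - F j A) \<longlongrightarrow> m (Suc -` A) - m A) H"
        by (intro tendsto_diff lim)
      ultimately show "m (Suc -` A) = m A" using tendsto_unique[OF \<open>H \<noteq> bot\<close>] by fastforce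
    qed
  next
    fix A c assume c: "\<And>j. c * real (L j) \<le> real (card (A \<inter> {a j..<a j + L j}))"
    have "eventually (\<lambda>j. c \<le> F j A) sequentially"
      using Lpos by eventually_elim (use c in \<open>simp add: F_def le_divide_eq\<close>)
    then have "eventually (\<lambda>j. c \<le> F j A) H" using Hseq by (simp add: filter_leD)
    then show "c \<le> m A" by (rule tendsto_lowerbound[OF lim _ \<open>H \<noteq> bot\<close>])
  qed
qed

section \<open>Borel sets of a topology\<close>

lemma openin_Pow_topspace: "{U. openin X U} \<subseteq> Pow (topspace X)"
  using openin_subset by blast

lemma sets_borel_of: "sets (borel_of X) = sigma_sets (topspace X) {U. openin X U}"
  unfolding borel_of_def by (rule sets_measure_of[OF openin_Pow_topspace])

lemma space_borel_of: "space (borel_of X) = topspace X"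
  unfolding borel_of_def by (rule space_measure_of[OF openin_Pow_topspace])

lemma openin_in_borel_of: "openin X U \<Longrightarrow> U \<in> sets (borel_of X)"
  by (simp add: sets_borel_of)

lemma sets_borel_of_closedin: "sets (borel_of X) = sigma_sets (topspace X) {K. closedin X K}"
  unfolding sets_borel_of
proof (rule sigma_sets_eqI)
  fix U assume "U \<in> {U. openin X U}"
  then have "topspace X - (topspace X - U) \<in> sigma_sets (topspace X) {K. closedin X K}"
    by (intro sigma_sets.Compl sigma_sets.Basic) auto
  then show "U \<in> sigma_sets (topspace X) {K. closedin X K}"
    using \<open>U \<in> _\<close> by (simp add: double_diff openin_subset)
next
  fix K assume "K \<in> {K. closedin X K}"
  then have "topspace X - (topspace X - K) \<in> sigma_sets (topspace X) {U. openin X U}"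
    by (intro sigma_sets.Compl sigma_sets.Basic) auto
  then show "K \<in> sigma_sets (topspace X) {U. openin X U}"
    using \<open>K \<in> _\<close> by (simp add: double_diff closedin_subset)
qed

lemma closedin_in_borel_of: "closedin X K \<Longrightarrow> K \<in> sets (borel_of X)"
  by (simp add: sets_borel_of_closedin)

lemma measurable_continuous_map:
  assumes f: "continuous_map X X' f"
    and M: "sets M = sets (borel_of X)" and N: "sets N = sets (borel_of X')"
  shows "f \<in> measurable M N"
proof (rule measurable_sigma_sets)
  have sp: "space M = topspace X" using sets_eq_imp_space_eq[OF M] by (simp add: space_borel_of)
  show "sets N = sigma_sets (topspace X') {U. openin X' U}" by (simp add: N sets_borel_of)
  show "f \<in> space M \<rightarrow> topspace X'" using f by (auto simp: sp continuous_map_def)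
  fix U assume "U \<in> {U. openin X' U}"
  then have "openin X (f -` U \<inter> topspace X)"
    using f by (auto simp: continuous_map_def vimage_def Int_def conj_commute)
  then show "f -` U \<inter> space M \<in> sets M" by (simp add: sp M openin_in_borel_of)
qed (rule openin_Pow_topspace)

lemma measure_eqI_closedin:
  assumes M: "sets M = sets (borel_of X)" "finite_measure M" and N: "sets N = sets (borel_of X)"
    and eq: "\<And>K. closedin X K \<Longrightarrow> emeasure M K = emeasure N K"
  shows "M = N"
proof (rule measure_eqI_generator_eq[where E="{K. closedin X K}" and \<Omega>="topspace X" and A="\<lambda>_. topspace X"])
  show "Int_stable {K. closedin X K}" by (auto simp: Int_stable_def)
  show "{K. closedin X K} \<subseteq> Pow (topspace X)" by (auto dest: closedin_subset)
  show "emeasure M (topspace X) \<noteq> \<infinity>" using M(2) by (simp add: finite_measure.emeasure_finite)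
qed (use M N eq in \<open>auto simp: sets_borel_of_closedin\<close>)

section \<open>Invariant measures from means of an orbit\<close>

locale orbit_mean =
  fixes Y :: "'a topology" and y :: "nat \<Rightarrow> 'a" and m :: "nat set \<Rightarrow> real"
  assumes compact: "compact_space Y" and Hausdorff: "Hausdorff_space Y"
    and mean: "invariant_mean m" and y_in: "\<And>n. y n \<in> topspace Y"
begin

definition hit :: "'a set \<Rightarrow> ennreal" where
  "hit A = ennreal (m (y -` A))"

text \<open>The value \<open>hit K\<close> itself is useless for a closed set, since the orbit may approach \<open>K\<close>
  without entering it; the infimum over neighbourhoods repairs this.\<close>

definition content :: "'a set \<Rightarrow> ennreal" where
  "content K = (INF U\<in>{U. openin Y U \<and> K \<subseteq> U}. hit U)"

definition inner_content :: "'a set \<Rightarrow> ennreal" where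
  "inner_content U = (SUP K\<in>{K. closedin Y K \<and> K \<subseteq> U}. content K)"

definition outer :: "'a set \<Rightarrow> ennreal" where
  "outer A = (INF U\<in>{U. openin Y U \<and> A \<subseteq> U}. inner_content U)"

definition mean_measure :: "'a measure" where
  "mean_measure = measure_of (topspace Y) {U. openin Y U} outer"

lemma hit_Un_disjoint: "A \<inter> B = {} \<Longrightarrow> hit (A \<union> B) = hit A + hit B"
proof -
  assume "A \<inter> B = {}"
  then have "y -` A \<inter> y -` B = {}" by blast
  then have "m (y -` A \<union> y -` B) = m (y -` A) + m (y -` B)"
    using mean by (simp add: invariant_mean_def)
  moreover have "0 \<le> m (y -` A)" "0 \<le> m (y -` B)"
    using mean by (simp_all add: invariant_mean_def)
  ultimately show "hit (A \<union> B) = hit A + hit B"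
    by (simp add: hit_def vimage_Un ennreal_plus)
qed

lemma hit_mono: "A \<subseteq> B \<Longrightarrow> hit A \<le> hit B"
  using hit_Un_disjoint[of A "B - A"] by (simp add: Un_absorb1)

lemma hit_Un_le: "hit (A \<union> B) \<le> hit A + hit B"
  using hit_Un_disjoint[of A "B - A"] hit_mono[of "B - A" B] by (simp add: add_left_mono)

lemma hit_topspace: "hit (topspace Y) = 1"
proof -
  have "y -` topspace Y = UNIV" using y_in by auto
  then show ?thesis using mean by (simp add: hit_def invariant_mean_def)
qed

lemma normal: "closedin Y K \<Longrightarrow> closedin Y L \<Longrightarrow> K \<inter> L = {} \<Longrightarrow>
    \<exists>U V. openin Y U \<and> openin Y V \<and> K \<subseteq> U \<and> L \<subseteq> V \<and> U \<inter> V = {}"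
  using compact_Hausdorff_or_regular_imp_normal_space[OF compact] Hausdorff
  unfolding normal_space_def disjnt_def by blast

lemma content_le: "openin Y U \<Longrightarrow> K \<subseteq> U \<Longrightarrow> content K \<le> hit U"
  unfolding content_def by (rule INF_lower) simp

lemma hit_le_content: "hit K \<le> content K"
  unfolding content_def by (rule INF_greatest) (simp add: hit_mono)

lemma content_finite: "K \<subseteq> topspace Y \<Longrightarrow> content K < top"
  using content_le[of "topspace Y" K] hit_topspace by (simp add: order_le_less_trans)

lemma content_approx:
  assumes "K \<subseteq> topspace Y" "0 < (e::real)"
  obtains U where "openin Y U" "K \<subseteq> U" "hit U \<le> content K + ennreal e"
proof -
  have "content K \<noteq> \<infinity>" using content_finite[OF assms(1)] by simp
  then obtain U where "openin Y U" "K \<subseteq> U" "hit U < content K + ennreal e"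
    using INF_approx_ennreal[OF assms(2) content_def[of K]] by auto
  then show ?thesis using that[of U] by (simp add: less_imp_le)
qed

lemma content_Un_le:
  assumes "K \<subseteq> topspace Y" "L \<subseteq> topspace Y"
  shows "content (K \<union> L) \<le> content K + content L"
proof (rule ennreal_le_epsilon)
  fix e :: real assume e: "0 < e"
  obtain U where U: "openin Y U" "K \<subseteq> U" "hit U \<le> content K + ennreal (e/2)"
    using content_approx[OF assms(1)] e half_gt_zero by metis
  obtain V where V: "openin Y V" "L \<subseteq> V" "hit V \<le> content L + ennreal (e/2)"
    using content_approx[OF assms(2)] e half_gt_zero by metis
  have "content (K \<union> L) \<le> hit (U \<union> V)" using U V by (intro content_le) auto
  also have "\<dots> \<le> hit U + hit V" by (rule hit_Un_le)
  also have "\<dots> \<le> (content K + ennreal (e/2)) + (content L + ennreal (e/2))"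
    by (intro add_mono U V)
  also have "\<dots> = content K + content L + (ennreal (e/2) + ennreal (e/2))"
    by (simp add: ac_simps)
  also have "ennreal (e/2) + ennreal (e/2) = ennreal e"
    using e by (simp flip: ennreal_plus)
  finally show "content (K \<union> L) \<le> content K + content L + ennreal e" .
qed

text \<open>Disjoint closed sets have disjoint neighbourhoods, on which the finitely additive \<open>hit\<close> splits.\<close>

lemma content_Un_disjoint:
  assumes "closedin Y K" "closedin Y L" "K \<inter> L = {}"
  shows "content K + content L \<le> content (K \<union> L)"
  unfolding content_def[of "K \<union> L"]
proof (rule INF_greatest)
  fix W assume "W \<in> {U. openin Y U \<and> K \<union> L \<subseteq> U}"
  then have W: "openin Y W" "K \<subseteq> W" "L \<subseteq> W" by auto
  obtain U V where UV: "openin Y U" "openin Y V" "K \<subseteq> U" "L \<subseteq> V" "U \<inter> V = {}"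
    using normal[OF assms] by blast
  have "content K + content L \<le> hit (W \<inter> U) + hit (W \<inter> V)"
    using W UV by (intro add_mono content_le) auto
  also have "\<dots> = hit ((W \<inter> U) \<union> (W \<inter> V))"
    using UV by (subst hit_Un_disjoint) auto
  also have "\<dots> \<le> hit W" by (rule hit_mono) auto
  finally show "content K + content L \<le> hit W" .
qed

lemma inner_content_le_hit: "openin Y U \<Longrightarrow> inner_content U \<le> hit U"
  unfolding inner_content_def by (rule SUP_least) (simp add: content_le)

lemma content_le_inner_content: "closedin Y K \<Longrightarrow> K \<subseteq> U \<Longrightarrow> content K \<le> inner_content U"
  unfolding inner_content_def by (rule SUP_upper) simp

lemma inner_content_mono: "U \<subseteq> V \<Longrightarrow> inner_content U \<le> inner_content V"
  unfolding inner_content_def by (rule SUP_subset_mono) auto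

lemma inner_content_finite: "openin Y U \<Longrightarrow> inner_content U < top"
proof -
  assume U: "openin Y U"
  have "inner_content U \<le> hit (topspace Y)"
    using inner_content_le_hit[OF U] hit_mono[OF openin_subset[OF U]] by (rule order_trans)
  then show "inner_content U < top" by (simp add: hit_topspace order_le_less_trans)
qed

lemma inner_content_approx:
  assumes "openin Y U" "0 < (e::real)"
  obtains K where "closedin Y K" "K \<subseteq> U" "inner_content U \<le> content K + ennreal e"
proof -
  have "{K. closedin Y K \<and> K \<subseteq> U} \<noteq> {}" by (auto intro: exI[of _ "{}"])
  moreover have "inner_content U \<noteq> \<infinity>" using inner_content_finite[OF assms(1)] by simp
  ultimately obtain K where "closedin Y K" "K \<subseteq> U" "inner_content U < content K + ennreal e"
    using SUP_approx_ennreal[OF assms(2) _ inner_content_def[of U]] by auto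
  then show ?thesis using that[of K] by (simp add: less_imp_le)
qed

text \<open>By normality, a closed subset of \<open>U \<union> V\<close> is the union of a closed subset of \<open>U\<close> and a closed
  subset of \<open>V\<close>.\<close>

lemma inner_content_Un_le:
  assumes U: "openin Y U" and V: "openin Y V"
  shows "inner_content (U \<union> V) \<le> inner_content U + inner_content V"
  unfolding inner_content_def[of "U \<union> V"]
proof (rule SUP_least)
  fix K assume "K \<in> {K. closedin Y K \<and> K \<subseteq> U \<union> V}"
  then have K: "closedin Y K" "K \<subseteq> U \<union> V" by auto
  have N: "closedin Y (K - U)" "closedin Y (K - V)" "(K - U) \<inter> (K - V) = {}"
    using closedin_diff[OF K(1) U] closedin_diff[OF K(1) V] K(2) by auto
  then obtain A B where AB: "openin Y A" "openin Y B" "K - U \<subseteq> A" "K - V \<subseteq> B" "A \<inter> B = {}"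
    using normal[OF N] by blast
  have cl: "closedin Y (K - A)" "closedin Y (K - B)"
    using closedin_diff[OF K(1) AB(1)] closedin_diff[OF K(1) AB(2)] by auto
  have eq: "(K - A) \<union> (K - B) = K" using AB(5) by auto
  have "content K \<le> content (K - A) + content (K - B)"
    using content_Un_le[OF closedin_subset[OF cl(1)] closedin_subset[OF cl(2)]] unfolding eq .
  also have "\<dots> \<le> inner_content U + inner_content V"
    using AB(3,4) K(2) by (intro add_mono content_le_inner_content cl) auto
  finally show "content K \<le> inner_content U + inner_content V" .
qed

lemma inner_content_empty: "inner_content {} = 0"
proof -
  have "m ({} \<union> {}) = m {} + m {}"
    using mean unfolding invariant_mean_def by blast
  then have "hit {} = 0" by (simp add: hit_def)
  then show ?thesis using inner_content_le_hit[of "{}"] by simp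
qed

lemma inner_content_finite_Union_le:
  assumes "\<And>i. openin Y (U i)"
  shows "inner_content (\<Union>i<n. U i) \<le> (\<Sum>i<(n::nat). inner_content (U i))"
proof (induction n)
  case 0 then show ?case by (simp add: inner_content_empty)
next
  case (Suc n)
  have "inner_content (\<Union>i<Suc n. U i) \<le> inner_content (\<Union>i<n. U i) + inner_content (U n)"
    using inner_content_Un_le[of "\<Union>i<n. U i" "U n"] assms openin_Union[of "U ` {..<n}" Y]
    by (auto simp: lessThan_Suc Un_commute)
  also have "\<dots> \<le> (\<Sum>i<n. inner_content (U i)) + inner_content (U n)"
    by (rule add_right_mono[OF Suc])
  finally show ?case by simp
qed

text \<open>Countable subadditivity comes for free from compactness: a closed subset of the union is
  already covered by finitely many of the sets.\<close>

lemma inner_content_countable_Union_le: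
  assumes U: "\<And>i::nat. openin Y (U i)"
  shows "inner_content (\<Union>i. U i) \<le> (\<Sum>i. inner_content (U i))"
  unfolding inner_content_def[of "\<Union>i. U i"]
proof (rule SUP_least)
  fix K assume "K \<in> {K. closedin Y K \<and> K \<subseteq> (\<Union>i. U i)}"
  then have K: "closedin Y K" "K \<subseteq> (\<Union>i. U i)" by auto
  have "compactin Y K" using K compact by (simp add: closedin_compact_space)
  then obtain F where F: "finite F" "F \<subseteq> range U" "K \<subseteq> \<Union>F"
    using K U unfolding compactin_def by (metis (no_types, lifting) imageE)
  then obtain I where I: "finite I" "F = U ` I" by (meson finite_subset_image)
  then obtain n where "I \<subseteq> {..<n}" using finite_nat_bounded by blast
  then have "K \<subseteq> (\<Union>i<n. U i)" using F I by blast
  then have "content K \<le> inner_content (\<Union>i<n. U i)"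
    by (rule content_le_inner_content[OF K(1)])
  also have "\<dots> \<le> (\<Sum>i<n. inner_content (U i))"
    by (rule inner_content_finite_Union_le[OF U])
  also have "\<dots> \<le> (\<Sum>i. inner_content (U i))"
    by (rule sum_le_suminf) auto
  finally show "content K \<le> (\<Sum>i. inner_content (U i))" .
qed

lemma outer_open: "openin Y U \<Longrightarrow> outer U = inner_content U"
  unfolding outer_def
  by (rule antisym) (auto intro!: INF_lower INF_greatest inner_content_mono)

lemma outer_mono: "A \<subseteq> B \<Longrightarrow> outer A \<le> outer B"
  unfolding outer_def by (rule INF_superset_mono) auto

lemma outer_finite: "A \<subseteq> topspace Y \<Longrightarrow> outer A < top"
  using outer_mono[of A "topspace Y"] inner_content_finite[of "topspace Y"]
  by (simp add: outer_open order_le_less_trans)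

lemma outer_approx:
  assumes "A \<subseteq> topspace Y" "0 < (e::real)"
  obtains U where "openin Y U" "A \<subseteq> U" "outer U \<le> outer A + ennreal e"
proof -
  have "outer A \<noteq> \<infinity>" using outer_finite[OF assms(1)] by simp
  then obtain U where "openin Y U" "A \<subseteq> U" "inner_content U < outer A + ennreal e"
    using INF_approx_ennreal[OF assms(2) outer_def[of A]] by auto
  then show ?thesis using that[of U] by (simp add: less_imp_le outer_open)
qed

text \<open>The infimum over neighbourhoods in the definition of \<open>content\<close> makes the content regular, so
  that passing to open sets and back loses nothing.\<close>

lemma outer_closed:
  assumes "closedin Y K"
  shows "outer K = content K"
proof (rule antisym)
  show "outer K \<le> content K"
  proof (rule ennreal_le_epsilon)
    fix e :: real assume "0 < e"
    then obtain U where U: "openin Y U" "K \<subseteq> U" "hit U \<le> content K + ennreal e"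
      using content_approx closedin_subset[OF assms] by blast
    have "outer K \<le> inner_content U" using U outer_mono[of K U] by (simp add: outer_open)
    also have "\<dots> \<le> hit U" by (rule inner_content_le_hit[OF U(1)])
    also note U(3)
    finally show "outer K \<le> content K + ennreal e" .
  qed
  show "content K \<le> outer K"
    unfolding outer_def using assms by (auto intro!: INF_greatest content_le_inner_content)
qed

lemma outer_measure_space_outer: "outer_measure_space (Pow (topspace Y)) outer"
  unfolding outer_measure_space_def
proof (intro conjI)
  show "positive (Pow (topspace Y)) outer"
    by (simp add: positive_def outer_open inner_content_empty)
  show "increasing (Pow (topspace Y)) outer"
    by (simp add: increasing_def outer_mono)
  show "countably_subadditive (Pow (topspace Y)) outer"
    unfolding countably_subadditive_def
  proof (intro allI impI)
    fix A :: "nat \<Rightarrow> 'a set" assume A: "range A \<subseteq> Pow (topspace Y)"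
    show "outer (\<Union>i. A i) \<le> (\<Sum>i. outer (A i))"
    proof (rule ennreal_le_epsilon)
      fix e :: real assume e: "0 < e"
      have "\<exists>U. openin Y U \<and> A i \<subseteq> U \<and> outer U \<le> outer (A i) + ennreal (e * (1/2)^Suc i)" for i
      proof -
        have "A i \<subseteq> topspace Y" "0 < e * (1/2)^Suc i" using A e by auto
        from outer_approx[OF this] show ?thesis by blast
      qed
      then obtain U where U: "\<And>i. openin Y (U i)" "\<And>i. A i \<subseteq> U i"
        "\<And>i. outer (U i) \<le> outer (A i) + ennreal (e * (1/2)^Suc i)" by metis
      have "outer (\<Union>i. A i) \<le> outer (\<Union>i. U i)" using U by (intro outer_mono) blast
      also have "\<dots> = inner_content (\<Union>i. U i)" using U by (intro outer_open openin_Union) auto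
      also have "\<dots> \<le> (\<Sum>i. outer (U i))"
        using inner_content_countable_Union_le[of U] U by (simp add: outer_open)
      also have "\<dots> \<le> (\<Sum>i. outer (A i) + ennreal (e * (1/2)^Suc i))"
        by (intro suminf_le U) auto
      also have "\<dots> = (\<Sum>i. outer (A i)) + (\<Sum>i. ennreal e * ennreal ((1/2)^Suc i))"
        using e by (subst suminf_add[symmetric])
          (auto simp del: ennreal_suminf_cmult simp add: ennreal_mult[symmetric])
      also have "(\<Sum>i. ennreal e * ennreal ((1/2)^Suc i)) = ennreal e"
        unfolding ennreal_suminf_cmult
        by (subst suminf_ennreal_eq[OF zero_le_power power_half_series]) auto
      finally show "outer (\<Union>i. A i) \<le> (\<Sum>i. outer (A i)) + ennreal e" .
    qed
  qed
qed

text \<open>Exhaust \<open>V \<inter> U\<close> by a closed set \<open>K\<close> and then the open set \<open>V - K\<close>, which contains \<open>V - U\<close>,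
  by a closed set \<open>L\<close>: the contents of the disjoint sets \<open>K\<close> and \<open>L\<close> add up inside \<open>V\<close>.\<close>

lemma outer_split_open:
  assumes U: "openin Y U" and V: "openin Y V"
  shows "outer (V \<inter> U) + outer (V - U) \<le> outer V"
proof (rule ennreal_le_epsilon)
  fix e :: real assume e: "0 < e"
  have VU: "openin Y (V \<inter> U)" using U V by auto
  obtain K where K: "closedin Y K" "K \<subseteq> V \<inter> U" "inner_content (V \<inter> U) \<le> content K + ennreal (e/2)"
    using inner_content_approx[OF VU, of "e/2"] e by auto
  have VK: "openin Y (V - K)" using V K by auto
  obtain L where L: "closedin Y L" "L \<subseteq> V - K" "inner_content (V - K) \<le> content L + ennreal (e/2)"
    using inner_content_approx[OF VK, of "e/2"] e by auto
  have "outer (V \<inter> U) + outer (V - U) \<le> inner_content (V \<inter> U) + inner_content (V - K)"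
    using K VU VK outer_mono[of "V - U" "V - K"] by (intro add_mono) (auto simp: outer_open)
  also have "\<dots> \<le> (content K + ennreal (e/2)) + (content L + ennreal (e/2))"
    by (intro add_mono K L)
  also have "\<dots> = content K + content L + (ennreal (e/2) + ennreal (e/2))"
    by (simp add: ac_simps)
  also have "ennreal (e/2) + ennreal (e/2) = ennreal e"
    using e by (simp flip: ennreal_plus)
  also have "content K + content L \<le> content (K \<union> L)"
    using K L by (intro content_Un_disjoint) auto
  also have "content (K \<union> L) \<le> outer V"
    using K L V by (auto simp: outer_open intro!: content_le_inner_content closedin_Un)
  finally show "outer (V \<inter> U) + outer (V - U) \<le> outer V + ennreal e"
    by (simp add: add_right_mono)
qed

lemma open_in_lambda_system:
  assumes U: "openin Y U"
  shows "U \<in> lambda_system (topspace Y) (Pow (topspace Y)) outer"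
proof -
  interpret sigma_algebra "topspace Y" "Pow (topspace Y)" by (rule sigma_algebra_Pow)
  have sub: "outer (A \<inter> U) + outer (A - U) = outer A" if A: "A \<subseteq> topspace Y" for A
  proof (rule antisym)
    show "outer (A \<inter> U) + outer (A - U) \<le> outer A"
    proof (rule ennreal_le_epsilon)
      fix e :: real assume e: "0 < e"
      then obtain V where V: "openin Y V" "A \<subseteq> V" "outer V \<le> outer A + ennreal e"
        using outer_approx[OF A] by blast
      have "outer (A \<inter> U) + outer (A - U) \<le> outer (V \<inter> U) + outer (V - U)"
        using V by (intro add_mono outer_mono) auto
      also have "\<dots> \<le> outer V" by (rule outer_split_open[OF U V(1)])
      also note V(3)
      finally show "outer (A \<inter> U) + outer (A - U) \<le> outer A + ennreal e" .
    qed
    have "subadditive (Pow (topspace Y)) outer"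
      using outer_measure_space_outer countably_subadditive_subadditive
      unfolding outer_measure_space_def by blast
    then have "outer ((A \<inter> U) \<union> (A - U)) \<le> outer (A \<inter> U) + outer (A - U)"
      by (rule subadditiveD) (use A in auto)
    then show "outer A \<le> outer (A \<inter> U) + outer (A - U)"
      by (simp add: Int_Diff_Un)
  qed
  then show ?thesis
    unfolding lambda_system_eq using openin_subset[OF U] by auto
qed

lemma sets_mean_measure: "sets mean_measure = sets (borel_of Y)"
  unfolding mean_measure_def borel_of_def by (simp only: sets_measure_of[OF openin_Pow_topspace])

lemma space_mean_measure: "space mean_measure = topspace Y"
  unfolding mean_measure_def by (rule space_measure_of[OF openin_Pow_topspace])

lemma emeasure_mean_measure:
  assumes "A \<in> sets (borel_of Y)"
  shows "emeasure mean_measure A = outer A"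
proof -
  interpret sigma_algebra "topspace Y" "Pow (topspace Y)" by (rule sigma_algebra_Pow)
  let ?L = "lambda_system (topspace Y) (Pow (topspace Y)) outer"
  let ?B = "sigma_sets (topspace Y) {U. openin Y U}"
  have ms: "measure_space (topspace Y) ?L outer"
    using caratheodory_lemma[OF outer_measure_space_outer] by simp
  have "?B \<subseteq> ?L"
    using ms open_in_lambda_system unfolding measure_space_def
    by (intro sigma_algebra.sigma_sets_subset) auto
  then have "measure_space (topspace Y) ?B outer"
    by (intro measure_down[OF ms] sigma_algebra_sigma_sets openin_Pow_topspace)
  then have "positive (sets mean_measure) outer" "countably_additive (sets mean_measure) outer"
    by (simp_all add: measure_space_def sets_mean_measure sets_borel_of)
  from emeasure_measure_of[OF mean_measure_def openin_Pow_topspace this] show ?thesis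
    using assms by (simp add: sets_mean_measure)
qed

lemma emeasure_topspace: "emeasure mean_measure (topspace Y) = 1"
proof -
  have "content (topspace Y) = 1"
    using hit_le_content[of "topspace Y"] content_le[of "topspace Y" "topspace Y"] hit_topspace
    by auto
  then show ?thesis
    by (simp add: emeasure_mean_measure closedin_in_borel_of outer_closed)
qed

lemma prob_space_mean_measure: "prob_space mean_measure"
  by (rule prob_spaceI) (simp add: space_mean_measure emeasure_topspace)

lemma emeasure_outer_regular:
  assumes A: "A \<in> sets (borel_of Y)"
  shows "emeasure mean_measure A = (INF U\<in>{U. openin Y U \<and> A \<subseteq> U}. emeasure mean_measure U)"
proof -
  have "(INF U\<in>{U. openin Y U \<and> A \<subseteq> U}. emeasure mean_measure U) =
        (INF U\<in>{U. openin Y U \<and> A \<subseteq> U}. inner_content U)"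
    by (rule INF_cong) (auto simp: emeasure_mean_measure openin_in_borel_of outer_open)
  then show ?thesis using A by (simp add: emeasure_mean_measure outer_def)
qed

text \<open>Outer regularity for the complement, as closed sets are compact.\<close>

lemma emeasure_inner_regular:
  assumes A: "A \<in> sets (borel_of Y)"
  shows "emeasure mean_measure A = (SUP K\<in>{K. compactin Y K \<and> K \<subseteq> A}. emeasure mean_measure K)"
proof (rule antisym)
  interpret M: prob_space mean_measure by (rule prob_space_mean_measure)
  have AY: "A \<subseteq> topspace Y" using A sets.sets_into_space sets_mean_measure space_mean_measure
    by metis
  show "emeasure mean_measure A \<le> (SUP K\<in>{K. compactin Y K \<and> K \<subseteq> A}. emeasure mean_measure K)"
  proof (rule ennreal_le_epsilon)
    fix e :: real assume e: "0 < e"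
    obtain U where U: "openin Y U" "topspace Y - A \<subseteq> U" "outer U \<le> outer (topspace Y - A) + ennreal e"
      using outer_approx[of "topspace Y - A" e] e by auto
    have Ac: "topspace Y - A \<in> sets mean_measure"
      using A by (metis sets.compl_sets sets_mean_measure space_mean_measure)
    have Us: "U \<in> sets mean_measure" "A \<in> sets mean_measure"
      using U A by (auto simp: sets_mean_measure openin_in_borel_of)
    have K: "compactin Y (topspace Y - U)" "topspace Y - U \<subseteq> A"
      using U AY compact by (auto intro: closedin_compact_space)
    have "measure mean_measure U \<le> measure mean_measure (topspace Y - A) + e"
      using U(3) Ac Us e by (simp add: emeasure_mean_measure[symmetric] sets_mean_measure M.emeasure_eq_measure
          flip: ennreal_plus)
    moreover have "measure mean_measure (topspace Y - A) = 1 - measure mean_measure A"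
      using M.prob_compl[OF Us(2)] by (simp add: space_mean_measure)
    moreover have "measure mean_measure (topspace Y - U) = 1 - measure mean_measure U"
      using M.prob_compl[OF Us(1)] by (simp add: space_mean_measure)
    ultimately have "measure mean_measure A \<le> measure mean_measure (topspace Y - U) + e" by linarith
    then have "emeasure mean_measure A \<le> emeasure mean_measure (topspace Y - U) + ennreal e"
      using e by (simp add: M.emeasure_eq_measure flip: ennreal_plus)
    also have "emeasure mean_measure (topspace Y - U) \<le>
        (SUP K\<in>{K. compactin Y K \<and> K \<subseteq> A}. emeasure mean_measure K)"
      using K by (intro SUP_upper) auto
    finally show "emeasure mean_measure A \<le>
        (SUP K\<in>{K. compactin Y K \<and> K \<subseteq> A}. emeasure mean_measure K) + ennreal e"
      by (simp add: add_right_mono)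
  qed
  show "(SUP K\<in>{K. compactin Y K \<and> K \<subseteq> A}. emeasure mean_measure K) \<le> emeasure mean_measure A"
    using A by (auto intro!: SUP_least emeasure_mono simp: sets_mean_measure)
qed

lemma regular_borel_prob_mean_measure: "regular_borel_prob Y mean_measure"
  unfolding regular_borel_prob_def
  using prob_space_mean_measure sets_mean_measure emeasure_outer_regular emeasure_inner_regular
  by simp

lemma hit_le_emeasure_closed: "closedin Y K \<Longrightarrow> m (y -` K) \<le> measure mean_measure K"
  using hit_le_content[of K]
    finite_measure.emeasure_eq_measure[OF prob_space.finite_measure[OF prob_space_mean_measure], of K]
  by (simp add: emeasure_mean_measure closedin_in_borel_of outer_closed hit_def)

lemma hit_vimage:
  assumes "\<And>n. S (y n) = y (Suc n)"
  shows "hit (S -` A) = hit A"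
proof -
  have "y -` S -` A = Suc -` (y -` A)" using assms by auto
  then show ?thesis using mean by (simp add: hit_def invariant_mean_def)
qed

text \<open>A continuous self-map \<open>S\<close> of a compact Hausdorff space is closed, so every open neighbourhood
  of the preimage of \<open>K\<close> contains the preimage of an open neighbourhood of \<open>K\<close>. Along the orbit,
  taking preimages under \<open>S\<close> is the shift of time, which the mean does not notice.\<close>

lemma content_vimage:
  assumes S: "continuous_map Y Y S" "\<And>n. S (y n) = y (Suc n)" and K: "closedin Y K"
  shows "content (S -` K \<inter> topspace Y) = content K"
proof (rule antisym)
  have hit: "hit (S -` V \<inter> topspace Y) = hit V" for V
  proof -
    have "y -` (S -` V \<inter> topspace Y) = y -` (S -` V)" using y_in by auto
    then show ?thesis using hit_vimage[OF S(2)] by (simp add: hit_def)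
  qed
  show "content (S -` K \<inter> topspace Y) \<le> content K"
    unfolding content_def[of K]
  proof (rule INF_greatest)
    fix V assume "V \<in> {U. openin Y U \<and> K \<subseteq> U}"
    then have "openin Y (S -` V \<inter> topspace Y)" "K \<subseteq> V"
      using S(1) by (auto simp: continuous_map_def vimage_def Int_def conj_commute)
    then have "content (S -` K \<inter> topspace Y) \<le> hit (S -` V \<inter> topspace Y)"
      by (intro content_le) auto
    then show "content (S -` K \<inter> topspace Y) \<le> hit V" using hit by simp
  qed
  show "content K \<le> content (S -` K \<inter> topspace Y)"
    unfolding content_def[of "S -` K \<inter> topspace Y"]
  proof (rule INF_greatest)
    fix U assume "U \<in> {U. openin Y U \<and> S -` K \<inter> topspace Y \<subseteq> U}"
    then have U: "openin Y U" "S -` K \<inter> topspace Y \<subseteq> U" by auto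
    define V where "V = topspace Y - S ` (topspace Y - U)"
    have "closed_map Y Y S"
      using continuous_imp_closed_map[OF S(1) compact Hausdorff] .
    then have "closedin Y (S ` (topspace Y - U))"
      using U(1) closedin_diff[OF closedin_topspace U(1)] by (simp add: closed_map_def)
    then have "openin Y V" by (simp add: V_def openin_diff)
    moreover have "K \<subseteq> V" using U(2) closedin_subset[OF K] by (auto simp: V_def)
    ultimately have "content K \<le> hit V" by (rule content_le)
    also have "\<dots> = hit (S -` V \<inter> topspace Y)" by (simp add: hit)
    also have "\<dots> \<le> hit U" by (rule hit_mono) (auto simp: V_def)
    finally show "content K \<le> hit U" .
  qed
qed

lemma distr_mean_measure:
  assumes S: "continuous_map Y Y S" "\<And>n. S (y n) = y (Suc n)"
  shows "distr mean_measure mean_measure S = mean_measure"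
proof -
  interpret M: prob_space mean_measure by (rule prob_space_mean_measure)
  have meas: "S \<in> measurable mean_measure mean_measure"
    by (rule measurable_continuous_map[OF S(1)]) (simp_all add: sets_mean_measure)
  show ?thesis
  proof (rule measure_eqI_closedin[of _ Y])
    show "finite_measure (distr mean_measure mean_measure S)"
      by (rule M.finite_measure_distr[OF meas])
    fix K assume K: "closedin Y K"
    have K': "closedin Y (S -` K \<inter> topspace Y)"
      using closedin_continuous_map_preimage[OF S(1) K] by (simp add: vimage_def Int_def conj_commute)
    show "emeasure (distr mean_measure mean_measure S) K = emeasure mean_measure K"
      using K K' content_vimage[OF S K]
      by (simp add: emeasure_distr[OF meas] sets_mean_measure closedin_in_borel_of
          space_mean_measure emeasure_mean_measure outer_closed)
  qed (simp_all add: sets_mean_measure)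
qed

end

theorem invariant_measure_of_orbit_mean:
  assumes "compact_space Y" "Hausdorff_space Y" "invariant_mean m" "\<And>n. y n \<in> topspace Y"
    and "continuous_map Y Y S" "\<And>n. S (y n) = y (Suc n)"
  obtains \<mu> where "regular_borel_prob Y \<mu>" "distr \<mu> \<mu> S = \<mu>"
    "\<And>K. closedin Y K \<Longrightarrow> m (y -` K) \<le> measure \<mu> K"
proof -
  interpret orbit_mean Y y m by unfold_locales (use assms in auto)
  show ?thesis
    by (rule that[OF regular_borel_prob_mean_measure distr_mean_measure[OF assms(5,6)]
        hit_le_emeasure_closed])
qed

section \<open>Periods, roots of unity and bump functions\<close>

text \<open>The exponents are chosen so that \<open>period (Suc k) / period k = 2 ^ (2 * k + 7)\<close> grows: this leaves
  room, inside a period of level \<open>Suc k\<close>, for a bump that is long compared with \<open>period k\<close> and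
  still has summably small density.\<close>

definition period :: "nat \<Rightarrow> nat" where
  "period k = 2 ^ (k * (k + 6))"

definition zeta :: "nat \<Rightarrow> complex" where
  "zeta k = cis (2 * pi / real (period k))"

text \<open>Any number on the circle that is not a root of unity would do; for this one the proof is a
  computation modulo \<open>5\<close>.\<close>

definition rot :: complex where
  "rot = Complex (3/5) (4/5)"

text \<open>A \<open>period k\<close>-periodic trapezoid around a quarter of the period, of height \<open>1/2\<close> and slope
  \<open>2 ^ (k + 5) / period k\<close>: it vanishes outside distance \<open>period k / 2 ^ (k + 5)\<close> of the centre
  and is constantly \<open>1/2\<close> within half of that distance.\<close>

definition bump :: "nat \<Rightarrow> nat \<Rightarrow> real" where
  "bump k n = max 0 (min (1/2)
     (1 - \<bar>real (n mod period k) - real (period k) / 4\<bar> * 2 ^ (k + 5) / real (period k)))"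

text \<open>The bump as a function of the root of unity \<open>zeta k ^ n\<close> rather than of the time \<open>n\<close>;
  by periodicity the choice of \<open>n\<close> is immaterial.\<close>

definition bump_at :: "nat \<Rightarrow> complex \<Rightarrow> real" where
  "bump_at k z = bump k (SOME n. z = zeta k ^ n)"

text \<open>The conditions on the coordinates from \<open>2\<close> on describe the inverse limit of the groups of roots
  of unity: each coordinate is the prescribed power of the next one.\<close>

definition carrier_set :: "(nat \<Rightarrow> complex) set" where
  "carrier_set = {w. (\<forall>i. cmod (w i) = 1) \<and> w 2 = 1 \<and>
     (\<forall>k. w (Suc k + 2) ^ (2 ^ (2 * k + 7)) = w (k + 2))}"

text \<open>The increment, under one step of the odometer, of the sum of all bumps. Along
  the orbit of the identity that sum is unbounded, so it has no continuous extension to the odometer, but the series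
  of the increments converges uniformly.\<close>

definition theta :: "(nat \<Rightarrow> complex) \<Rightarrow> real" where
  "theta w = (\<Sum>k. bump_at k (zeta k * w (k + 2)) - bump_at k (w (k + 2)))"

definition twist :: "(nat \<Rightarrow> complex) \<Rightarrow> nat \<Rightarrow> complex" where
  "twist w i = (if i = 0 then w 0 * w 1 * cis (2 * pi * theta w)
                else if i = 1 then rot * w 1 else zeta (i - 2) * w i)"

text \<open>All rules about the odometer coordinates are stated for the index \<open>k + 2\<close>, a form that the
  simplifier has to preserve.\<close>

declare add_2_eq_Suc' [simp del] add_2_eq_Suc [simp del]

lemma period_pos [simp]: "0 < period k"
  by (simp add: period_def)

lemma period_0 [simp]: "period 0 = 1"
  by (simp add: period_def)

lemma period_Suc: "period (Suc k) = period k * 2 ^ (2 * k + 7)"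
  by (simp add: period_def flip: power_add) (simp add: algebra_simps)

lemma period_mono: "k \<le> l \<Longrightarrow> period k \<le> period l"
  unfolding period_def by (intro power_increasing mult_le_mono) auto

lemma period_dvd: "k \<le> l \<Longrightarrow> period k dvd period l"
  unfolding period_def by (intro le_imp_power_dvd mult_le_mono) auto

lemma zeta_power: "zeta k ^ n = cis (2 * pi * real n / real (period k))"
  by (simp add: zeta_def Complex.DeMoivre ac_simps)

lemma zeta_period [simp]: "zeta k ^ period k = 1"
  by (simp add: zeta_power)

lemma norm_zeta [simp]: "cmod (zeta k) = 1"
  by (simp add: zeta_def)

lemma zeta_Suc: "zeta (Suc k) ^ (2 ^ (2 * k + 7)) = zeta k"
proof -
  have "2 * pi * real (2 ^ (2 * k + 7)) / real (period (Suc k)) = 2 * pi / real (period k)"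
    by (simp add: period_Suc)
  then show ?thesis unfolding zeta_power by (simp only: zeta_def)
qed

lemma zeta_power_mod: "zeta k ^ (n mod period k) = zeta k ^ n"
proof -
  have "zeta k ^ n = zeta k ^ (period k * (n div period k) + n mod period k)" by simp
  also have "\<dots> = zeta k ^ (n mod period k)" unfolding power_add power_mult by simp
  finally show ?thesis by simp
qed

lemma zeta_power_eq_iff: "zeta k ^ n = zeta k ^ n' \<longleftrightarrow> n mod period k = n' mod period k"
proof
  assume "zeta k ^ n = zeta k ^ n'"
  then have "zeta k ^ (n mod period k) = zeta k ^ (n' mod period k)"
    by (simp add: zeta_power_mod)
  moreover have "inj_on (\<lambda>j. cis (2 * pi * real j / real (period k))) {..<period k}"
    using Complex.bij_betw_roots_unity[OF period_pos] bij_betw_def by blast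
  ultimately show "n mod period k = n' mod period k"
    unfolding zeta_power by (auto dest!: inj_onD)
next
  assume "n mod period k = n' mod period k"
  then show "zeta k ^ n = zeta k ^ n'" by (metis zeta_power_mod)
qed

lemma zeta_power_eq_1_iff: "zeta k ^ n = 1 \<longleftrightarrow> period k dvd n"
  using zeta_power_eq_iff[of k n 0] by (simp add: mod_eq_0_iff_dvd)

lemma root_of_unity_eq_zeta_power:
  assumes "z ^ period k = 1"
  obtains n where "n < period k" "z = zeta k ^ n"
proof -
  have "z \<in> (\<lambda>j. cis (2 * pi * real j / real (period k))) ` {..<period k}"
    using Complex.bij_betw_roots_unity[OF period_pos, of k] assms unfolding bij_betw_def by auto
  then show ?thesis using that by (auto simp: zeta_power)
qed

lemma bump_mod: "bump k (n mod period k) = bump k n"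
  by (simp add: bump_def)

lemma bump_at_zeta_power: "bump_at k (zeta k ^ n) = bump k n"
proof -
  have "zeta k ^ n = zeta k ^ (SOME n'. zeta k ^ n = zeta k ^ n')"
    by (rule someI_ex[of "\<lambda>n'. zeta k ^ n = zeta k ^ n'"]) auto
  then have "n mod period k = (SOME n'. zeta k ^ n = zeta k ^ n') mod period k"
    by (simp only: zeta_power_eq_iff)
  then show ?thesis unfolding bump_at_def by (metis bump_mod)
qed

lemma bump_level_0: "bump 0 n = bump 0 0"
  by (simp add: bump_def)

lemma bump_eq_0:
  assumes "real (period k) \<le> \<bar>real (n mod period k) - real (period k) / 4\<bar> * 2 ^ (k + 5)"
  shows "bump k n = 0"
  using assms by (simp add: bump_def field_simps)

lemma bump_eq_half:
  assumes "\<bar>real (n mod period k) - real (period k) / 4\<bar> * 2 ^ (k + 6) \<le> real (period k)"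
  shows "bump k n = 1/2"
proof -
  have "\<bar>real (n mod period k) - real (period k) / 4\<bar> * 2 ^ (k + 5) * 2 \<le> real (period k)"
    using assms by (simp add: power_add)
  then have "\<bar>real (n mod period k) - real (period k) / 4\<bar> * 2 ^ (k + 5) / real (period k) \<le> 1/2"
    by (subst pos_divide_le_eq) auto
  then show ?thesis unfolding bump_def by linarith
qed

lemma period_ge: "1 \<le> k \<Longrightarrow> 2 ^ (2 * k + 5) \<le> period k"
  unfolding period_def
proof (intro power_increasing)
  assume "1 \<le> k"
  then obtain j where j: "k = Suc j" by (cases k) auto
  show "2 * k + 5 \<le> k * (k + 6)" unfolding j by (simp add: algebra_simps)
qed simp

lemma bump_eq_0_outside:
  assumes "real (n mod period k) \<le> real (period k) / 8 \<or> 3 * real (period k) / 8 \<le> real (n mod period k)"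
  shows "bump k n = 0"
proof (rule bump_eq_0)
  have "real (period k) / 8 \<le> \<bar>real (n mod period k) - real (period k) / 4\<bar>" using assms by linarith
  then have "real (period k) / 8 * 2 ^ 3 \<le> \<bar>real (n mod period k) - real (period k) / 4\<bar> * 2 ^ (k + 5)"
    by (intro mult_mono power_increasing) auto
  then show "real (period k) \<le> \<bar>real (n mod period k) - real (period k) / 4\<bar> * 2 ^ (k + 5)" by simp
qed

text \<open>The slope bounds the step inside a period, and near the two ends of a period the bump vanishes.
  Level \<open>0\<close> is separate: its formal slope is too large, but it is constant.\<close>

lemma bump_step: "\<bar>bump k (Suc n) - bump k n\<bar> \<le> (1/2) ^ k"
proof (cases "k = 0")
  case True then show ?thesis by (simp add: bump_level_0[of "Suc n"] bump_level_0[of n])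
next
  case False
  then have k: "1 \<le> k" by simp
  define p where "p = period k"
  have p: "2 ^ (2 * k + 5) \<le> p" using period_ge[OF k] by (simp add: p_def)
  have p32: "32 \<le> p"
    using p power_increasing[of 5 "2*k+5" "2::nat"] by simp
  show ?thesis
  proof (cases "Suc (n mod p) = p")
    case True
    then have 1: "Suc n mod p = 0" by (simp add: mod_Suc)
    then have "bump k (Suc n) = 0" by (intro bump_eq_0_outside) (simp add: p_def)
    moreover have "bump k n = 0"
    proof (rule bump_eq_0_outside)
      have "real (n mod p) = real p - 1" using True by linarith
      then show "real (n mod period k) \<le> real (period k) / 8 \<or> 3 * real (period k) / 8 \<le> real (n mod period k)"
        using p32 unfolding p_def[symmetric] by linarith
    qed
    ultimately show ?thesis by simp
  next
    case False
    then have 1: "Suc n mod p = Suc (n mod p)" by (simp add: mod_Suc)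
    define s where "s = 2 ^ (k + 5) / real p"
    define f where "f x = max 0 (min (1/2) (1 - \<bar>x - real p / 4\<bar> * s))" for x
    have "0 \<le> s" by (simp add: s_def)
    have B: "bump k n = f (real (n mod p))" for n
      by (simp add: bump_def f_def s_def p_def)
    define A where "A = \<bar>real (n mod p) - real p / 4\<bar> * s"
    define A' where "A' = \<bar>real (Suc (n mod p)) - real p / 4\<bar> * s"
    have "A' - A = (\<bar>real (Suc (n mod p)) - real p / 4\<bar> - \<bar>real (n mod p) - real p / 4\<bar>) * s"
      by (simp add: A_def A'_def algebra_simps)
    then have "\<bar>A' - A\<bar> = \<bar>\<bar>real (Suc (n mod p)) - real p / 4\<bar> - \<bar>real (n mod p) - real p / 4\<bar>\<bar> * s"
      using \<open>0 \<le> s\<close> by (simp add: abs_mult)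
    also have "\<dots> \<le> 1 * s" by (intro mult_right_mono \<open>0 \<le> s\<close>) auto
    finally have "\<bar>A' - A\<bar> \<le> s" by simp
    then have "\<bar>bump k (Suc n) - bump k n\<bar> \<le> s"
      unfolding B 1 f_def A_def[symmetric] A'_def[symmetric] by linarith
    also have "s \<le> (1/2) ^ k"
    proof -
      have "real (2 ^ (2 * k + 5)) \<le> real p" using p by (simp only: of_nat_le_iff)
      moreover have "(2::real) ^ (k + 5) * 2 ^ k = real (2 ^ (2 * k + 5))"
        by (subst power_add[symmetric]) (auto intro: arg_cong[where f="\<lambda>x. 2 ^ x"])
      ultimately have "(2::real) ^ (k + 5) * 2 ^ k \<le> real p" by (simp only:)
      then show ?thesis using p32 by (simp add: s_def field_simps power_divide)
    qed
    finally show ?thesis .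
  qed
qed

lemma norm_rot [simp]: "cmod rot = 1"
  by (simp add: rot_def cmod_def power2_eq_square)

text \<open>Modulo \<open>5\<close>, the Gaussian integer \<open>3 + 4 \<i>\<close> is idempotent, so its powers never become divisible
  by \<open>5\<close>, while \<open>5 * rot = 3 + 4 \<i>\<close>.\<close>

lemma rot_power_form:
  "\<exists>a b :: int. (5 * rot) ^ Suc n = Complex (of_int (5 * a + 3)) (of_int (5 * b + 4))"
proof (induction n)
  case 0
  show ?case by (rule exI[of _ 0], rule exI[of _ 0]) (simp add: rot_def complex_eq_iff)
next
  case (Suc n)
  then obtain a b :: int where ab: "(5 * rot) ^ Suc n = Complex (of_int (5 * a + 3)) (of_int (5 * b + 4))"
    by blast
  have "5 * rot = Complex 3 4" by (simp add: rot_def complex_eq_iff)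
  then have "(5 * rot) ^ Suc (Suc n) = Complex 3 4 * Complex (of_int (5 * a + 3)) (of_int (5 * b + 4))"
    using ab by (metis power_Suc)
  also have "\<dots> = Complex (of_int (5 * (3 * a - 4 * b - 2) + 3)) (of_int (5 * (3 * b + 4 * a + 4) + 4))"
    by (simp add: complex_eq_iff algebra_simps)
  finally show ?case by blast
qed

lemma rot_power_neq_1:
  assumes "0 < n"
  shows "rot ^ n \<noteq> 1"
proof
  assume "rot ^ n = 1"
  obtain n' where n: "n = Suc n'" using assms by (cases n) auto
  obtain a b :: int where ab: "(5 * rot) ^ n = Complex (of_int (5 * a + 3)) (of_int (5 * b + 4))"
    using rot_power_form n by blast
  have "(5 * rot) ^ n = 5 ^ n" using \<open>rot ^ n = 1\<close> by (simp add: power_mult_distrib)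
  then have "Im (5 ^ n :: complex) = of_int (5 * b + 4)" using ab by simp
  moreover have "Im (5 ^ n :: complex) = 0"
    by (metis Im_complex_of_real of_real_numeral of_real_power)
  ultimately have "5 * b + 4 = 0" by linarith
  then show False by presburger
qed

lemma rot_powi_neq_1: "j \<noteq> 0 \<Longrightarrow> rot powi j \<noteq> 1"
  using rot_power_neq_1[of "nat j"] rot_power_neq_1[of "nat (-j)"]
  by (auto simp: power_int_def power_inverse)

section \<open>The space and the skew product\<close>

lemma carrier_norm [simp]: "w \<in> carrier_set \<Longrightarrow> cmod (w i) = 1"
  unfolding carrier_set_def by blast

lemma carrier_nz [simp]: "w \<in> carrier_set \<Longrightarrow> w i \<noteq> 0"
  by (metis carrier_norm norm_zero zero_neq_one)

lemma carrier_2: "w \<in> carrier_set \<Longrightarrow> w 2 = 1"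
  unfolding carrier_set_def by blast

lemma carrier_setI:
  assumes "\<And>i. cmod (w i) = 1" "w 2 = 1"
    "\<And>k. w (Suc k + 2) ^ (2 ^ (2 * k + 7)) = w (k + 2)"
  shows "w \<in> carrier_set"
  using assms unfolding carrier_set_def by blast

lemma carrier_Suc: "w \<in> carrier_set \<Longrightarrow> w (Suc k + 2) ^ (2 ^ (2 * k + 7)) = w (k + 2)"
  unfolding carrier_set_def by blast

lemma carrier_period: "w \<in> carrier_set \<Longrightarrow> w (k + 2) ^ period k = 1"
proof (induction k)
  case 0 then show ?case using carrier_2[of w] by simp
next
  case (Suc k)
  have "w (Suc k + 2) ^ period (Suc k) = (w (Suc k + 2) ^ (2 ^ (2 * k + 7))) ^ period k"
    by (simp only: period_Suc power_mult[symmetric] mult.commute)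
  also have "\<dots> = 1" unfolding carrier_Suc[OF Suc.prems] by (rule Suc.IH[OF Suc.prems])
  finally show ?case .
qed

lemma carrier_coordinate_le:
  assumes "w \<in> carrier_set" "k \<le> l"
  shows "w (k + 2) = w (l + 2) ^ (period l div period k)"
  using assms(2)
proof (induction l rule: dec_induct)
  case base then show ?case by simp
next
  case (step l)
  have "period (Suc l) div period k = 2 ^ (2 * l + 7) * (period l div period k)"
    using period_dvd[OF step(1)] by (elim dvdE) (simp add: period_Suc less_imp_neq[OF period_pos, symmetric])
  then have "w (Suc l + 2) ^ (period (Suc l) div period k) =
      (w (Suc l + 2) ^ (2 ^ (2 * l + 7))) ^ (period l div period k)"
    by (simp only: power_mult)
  also have "\<dots> = w (k + 2)" unfolding carrier_Suc[OF assms(1)] by (rule step.IH[symmetric])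
  finally show ?case by simp
qed

lemma carrier_zeta:
  assumes "w \<in> carrier_set"
  obtains n where "w (k + 2) = zeta k ^ n"
  using root_of_unity_eq_zeta_power[OF carrier_period[OF assms]] by metis

lemma closed_carrier: "closed carrier_set"
proof -
  have "carrier_set = (\<Inter>i. {w. cmod (w i) = 1}) \<inter> {w. w 2 = 1} \<inter>
      (\<Inter>k. {w. w (Suc k + 2) ^ (2 ^ (2 * k + 7)) = w (k + 2)})"
    unfolding carrier_set_def by blast
  also have "closed \<dots>"
    by (intro closed_Int closed_INT ballI closed_Collect_eq continuous_intros
        continuous_on_product_coordinates continuous_on_power)
  finally show ?thesis .
qed

lemma compact_carrier: "compact carrier_set"
proof -
  have "compactin (product_topology (\<lambda>_::nat. euclidean) UNIV) (PiE UNIV (\<lambda>_. cball (0::complex) 1))"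
    unfolding compactin_PiE by auto
  then have "compact (PiE UNIV (\<lambda>_::nat. cball (0::complex) 1))"
    by (simp add: euclidean_product_topology)
  moreover have "carrier_set = carrier_set \<inter> PiE UNIV (\<lambda>_::nat. cball (0::complex) 1)"
    by (auto simp: PiE_UNIV_domain)
  ultimately show ?thesis using closed_carrier closed_Int_compact by metis
qed

lemma one_in_carrier: "(\<lambda>_. 1) \<in> carrier_set"
  by (rule carrier_setI) auto

lemma mult_in_carrier:
  assumes v: "v \<in> carrier_set" and w: "w \<in> carrier_set"
  shows "(\<lambda>i. v i * w i) \<in> carrier_set"
proof (rule carrier_setI)
  show "(v (Suc k + 2) * w (Suc k + 2)) ^ (2 ^ (2 * k + 7)) = v (k + 2) * w (k + 2)" for k
    unfolding power_mult_distrib carrier_Suc[OF v] carrier_Suc[OF w] ..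
qed (use v w in \<open>simp_all add: norm_mult carrier_2\<close>)

lemma cnj_in_carrier:
  assumes v: "v \<in> carrier_set"
  shows "(\<lambda>i. cnj (v i)) \<in> carrier_set"
proof (rule carrier_setI)
  show "cnj (v (Suc k + 2)) ^ (2 ^ (2 * k + 7)) = cnj (v (k + 2))" for k
    unfolding complex_cnj_power[symmetric] carrier_Suc[OF v] ..
qed (use v in \<open>simp_all add: carrier_2\<close>)

lemma coordinate_cases:
  fixes i :: nat
  obtains "i = 0" | "i = 1" | k where "i = k + 2"
proof (cases "i < 2")
  case True then show ?thesis using that by linarith
next
  case False
  then have "i = (i - 2) + 2" by simp
  then show ?thesis by (rule that(3))
qed

lemma twist_0: "twist w 0 = w 0 * w 1 * cis (2 * pi * theta w)"
  and twist_1: "twist w 1 = rot * w 1"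
  and twist_ge2: "twist w (k + 2) = zeta k * w (k + 2)"
  by (simp_all add: twist_def)

lemma twist_in_carrier:
  assumes w: "w \<in> carrier_set"
  shows "twist w \<in> carrier_set"
proof -
  have "cmod (twist w i) = 1" for i
    using w by (simp add: twist_def norm_mult)
  moreover have "twist w 2 = 1" using twist_ge2[of w 0] carrier_2[OF w] by (simp add: zeta_def)
  moreover have "twist w (Suc k + 2) ^ (2 ^ (2 * k + 7)) = twist w (k + 2)" for k
    unfolding twist_ge2 power_mult_distrib zeta_Suc carrier_Suc[OF w] ..
  ultimately show ?thesis by (rule carrier_setI)
qed

lemma theta_cong: "(\<And>k. v (k + 2) = w (k + 2)) \<Longrightarrow> theta v = theta w"
  unfolding theta_def by (rule suminf_cong) simp

lemma twist_inj: "inj_on twist carrier_set"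
proof (rule inj_onI)
  fix v w assume v: "v \<in> carrier_set" and w: "w \<in> carrier_set" and eq: "twist v = twist w"
  have k: "v (k + 2) = w (k + 2)" for k
  proof -
    have "zeta k * v (k + 2) = zeta k * w (k + 2)" using eq by (metis twist_ge2)
    moreover have "zeta k \<noteq> 0" by (metis norm_zeta norm_zero zero_neq_one)
    ultimately show ?thesis by simp
  qed
  have "rot * v 1 = rot * w 1" using eq by (metis twist_1)
  moreover have "rot \<noteq> 0" by (metis norm_rot norm_zero zero_neq_one)
  ultimately have 1: "v 1 = w 1" by simp
  have "v 0 * v 1 * cis (2 * pi * theta v) = w 0 * w 1 * cis (2 * pi * theta w)"
    using eq by (metis twist_0)
  then have 0: "v 0 = w 0" using 1 theta_cong[of v w, OF k] w by auto
  show "v = w"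
  proof
    fix i show "v i = w i" using 0 1 k by (cases i rule: coordinate_cases) auto
  qed
qed

lemma twist_surj:
  assumes w: "w \<in> carrier_set"
  shows "w \<in> twist ` carrier_set"
proof -
  define v' where "v' i = (if i < 2 then 1 else cnj (zeta (i - 2)) * w i)" for i
  define v where "v i = (if i = 0 then w 0 * cnj (cnj rot * w 1) * cnj (cis (2 * pi * theta v'))
      else if i = 1 then cnj rot * w 1 else v' i)" for i
  have vk: "v (k + 2) = cnj (zeta k) * w (k + 2)" for k by (simp add: v_def v'_def)
  have th: "theta v = theta v'" by (rule theta_cong) (simp add: v_def)
  have unit: "z * cnj z = 1" if "cmod z = 1" for z
    using that by (simp add: complex_norm_square[symmetric])
  have vin: "v \<in> carrier_set"
  proof -
    have "cmod (v i) = 1" for i using w by (simp add: v_def v'_def norm_mult)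
    moreover have "v 2 = 1" using vk[of 0] carrier_2[OF w] by (simp add: zeta_def)
    moreover have "v (Suc k + 2) ^ (2 ^ (2 * k + 7)) = v (k + 2)" for k
      unfolding vk power_mult_distrib carrier_Suc[OF w] complex_cnj_power[symmetric] zeta_Suc ..
    ultimately show ?thesis by (rule carrier_setI)
  qed
  have "twist v = w"
  proof
    fix i show "twist v i = w i"
    proof (cases i rule: coordinate_cases)
      case 1
      have "twist v 0 = w 0 * (cnj (cnj rot * w 1) * (cnj rot * w 1)) *
          (cnj (cis (2 * pi * theta v')) * cis (2 * pi * theta v'))"
        unfolding twist_0 th by (simp add: v_def ac_simps)
      also have "cnj (cnj rot * w 1) * (cnj rot * w 1) = 1"
        using unit[of "cnj rot * w 1"] w by (simp add: norm_mult mult.commute)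
      also have "cnj (cis (2 * pi * theta v')) * cis (2 * pi * theta v') = 1"
        using unit[of "cis (2 * pi * theta v')"] by (simp add: mult.commute)
      finally show ?thesis using 1 by simp
    next
      case 2
      have "twist v 1 = (rot * cnj rot) * w 1" unfolding twist_1 by (simp add: v_def)
      then show ?thesis using 2 unit[of rot] by simp
    next
      case (3 k)
      have "twist v (k + 2) = (zeta k * cnj (zeta k)) * w (k + 2)" unfolding twist_ge2 vk by simp
      then show ?thesis using 3 unit[of "zeta k"] by simp
    qed
  qed
  then show ?thesis using vin by blast
qed

lemma twist_image: "twist ` carrier_set = carrier_set"
  using twist_in_carrier twist_surj by blast

lemma finite_roots: "finite {z. z ^ period k = (1::complex)}"
  using finite_roots_unity[of "period k"] by (simp add: Suc_leI)

lemma continuous_on_coordinate: "continuous_on carrier_set (\<lambda>w. w i)"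
  by (rule continuous_on_subset[OF continuous_on_product_coordinates subset_UNIV])

text \<open>The coordinate takes finitely many values, so \<open>\<phi>\<close> may be an arbitrary function.\<close>

lemma continuous_on_odometer_coordinate:
  fixes \<phi> :: "complex \<Rightarrow> 'b::topological_space"
  shows "continuous_on carrier_set (\<lambda>w. \<phi> (w (k + 2)))"
proof (rule continuous_on_compose2[where g=\<phi> and f="\<lambda>w. w (k + 2)" and t="{z. z ^ period k = 1}"])
  show "continuous_on {z. z ^ period k = 1} \<phi>" by (rule continuous_on_finite[OF finite_roots])
qed (auto intro: carrier_period continuous_on_coordinate)

lemma bump_at_step:
  assumes "w \<in> carrier_set"
  shows "\<bar>bump_at k (zeta k * w (k + 2)) - bump_at k (w (k + 2))\<bar> \<le> (1/2) ^ k"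
proof -
  obtain n where "w (k + 2) = zeta k ^ n" using carrier_zeta[OF assms] by metis
  then show ?thesis
    using bump_step[of k n] bump_at_zeta_power[of k n] bump_at_zeta_power[of k "Suc n"] by simp
qed

lemma uniform_limit_theta:
  "uniform_limit carrier_set
     (\<lambda>N w. \<Sum>k<N. bump_at k (zeta k * w (k + 2)) - bump_at k (w (k + 2))) theta sequentially"
  unfolding theta_def
  by (rule Weierstrass_m_test[where M="\<lambda>k. (1/2)^k"]) (auto simp: bump_at_step)

lemma summable_theta:
  assumes "w \<in> carrier_set"
  shows "summable (\<lambda>k. bump_at k (zeta k * w (k + 2)) - bump_at k (w (k + 2)))"
  by (rule summable_comparison_test'[of "\<lambda>k. (1/2)^k"]) (use assms bump_at_step in auto)

lemma continuous_on_theta: "continuous_on carrier_set theta"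
proof (rule uniform_limit_theorem[OF _ uniform_limit_theta])
  show "\<forall>\<^sub>F N in sequentially. continuous_on carrier_set
     (\<lambda>w. \<Sum>k<N. bump_at k (zeta k * w (k + 2)) - bump_at k (w (k + 2)))"
    by (intro always_eventually allI continuous_on_sum)
      (rule continuous_on_odometer_coordinate[of "\<lambda>z. bump_at k (zeta k * z) - bump_at k z" for k])
qed simp

lemma continuous_on_twist: "continuous_on carrier_set twist"
proof (rule continuous_on_coordinatewise_then_product)
  fix i
  show "continuous_on carrier_set (\<lambda>w. twist w i)"
    unfolding twist_def
    by (cases "i = 0"; cases "i = 1"; simp)
      (intro continuous_intros continuous_on_coordinate continuous_on_theta)+
qed

section \<open>Iterates of monomials under the skew product\<close>

lemma funpow_twist_in_carrier: "w \<in> carrier_set \<Longrightarrow> (twist ^^ n) w \<in> carrier_set"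
  by (induction n) (auto simp: twist_in_carrier)

lemma funpow_twist_1: "(twist ^^ n) w 1 = rot ^ n * w 1"
  by (induction n) (auto simp: twist_1[simplified] ac_simps)

lemma funpow_twist_ge2: "(twist ^^ n) w (k + 2) = zeta k ^ n * w (k + 2)"
  by (induction n) (auto simp: twist_ge2 ac_simps)

lemma continuous_on_funpow_twist: "continuous_on carrier_set (twist ^^ n)"
proof (induction n)
  case 0 then show ?case by (simp add: continuous_on_id[unfolded id_def] id_def)
next
  case (Suc n)
  have "continuous_on carrier_set (\<lambda>w. twist ((twist ^^ n) w))"
    by (rule continuous_on_compose2[OF continuous_on_twist Suc])
      (auto simp: funpow_twist_in_carrier)
  then show ?case by (simp add: comp_def)
qed

text \<open>The continuous functions of the odometer variable alone, bounded by \<open>1\<close>, described as uniform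
  limits of functions of a single odometer coordinate.\<close>

definition odometer_limit :: "((nat \<Rightarrow> complex) \<Rightarrow> complex) \<Rightarrow> bool" where
  "odometer_limit \<Phi> \<longleftrightarrow> continuous_on carrier_set \<Phi> \<and> (\<forall>w\<in>carrier_set. cmod (\<Phi> w) \<le> 1) \<and>
     (\<forall>e>0. \<exists>K \<phi>. \<forall>w\<in>carrier_set. cmod (\<Phi> w - \<phi> (w (K + 2))) \<le> e)"

lemma odometer_raise:
  assumes "k \<le> K"
  obtains \<phi>' :: "complex \<Rightarrow> 'b" where "\<And>w. w \<in> carrier_set \<Longrightarrow> \<phi>' (w (K + 2)) = \<phi> (w (k + 2))"
  by (rule that[of "\<lambda>z. \<phi> (z ^ (period K div period k))"])
    (simp add: carrier_coordinate_le[OF _ assms])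

lemma odometer_limit_mult:
  assumes F: "odometer_limit F" and G: "odometer_limit G"
  shows "odometer_limit (\<lambda>w. F w * G w)"
  unfolding odometer_limit_def
proof (intro conjI ballI allI impI)
  show "continuous_on carrier_set (\<lambda>w. F w * G w)"
    using F G unfolding odometer_limit_def by (auto intro: continuous_intros)
  show "cmod (F w * G w) \<le> 1" if "w \<in> carrier_set" for w
    using F G that unfolding odometer_limit_def by (auto simp: norm_mult intro: mult_le_one)
  fix e :: real assume e: "0 < e"
  define d where "d = min 1 (e / 3)"
  have d: "0 < d" "d \<le> 1" "3 * d \<le> e" using e by (auto simp: d_def)
  obtain K f where f: "\<And>w. w \<in> carrier_set \<Longrightarrow> cmod (F w - f (w (K + 2))) \<le> d"
    using F d(1) unfolding odometer_limit_def by meson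
  obtain L g where g: "\<And>w. w \<in> carrier_set \<Longrightarrow> cmod (G w - g (w (L + 2))) \<le> d"
    using G d(1) unfolding odometer_limit_def by meson
  define M where "M = max K L"
  obtain f' :: "complex \<Rightarrow> complex" where f': "\<And>w. w \<in> carrier_set \<Longrightarrow> f' (w (M + 2)) = f (w (K + 2))"
    using odometer_raise[of K M f] by (auto simp: M_def)
  obtain g' :: "complex \<Rightarrow> complex" where g': "\<And>w. w \<in> carrier_set \<Longrightarrow> g' (w (M + 2)) = g (w (L + 2))"
    using odometer_raise[of L M g] by (auto simp: M_def)
  have "cmod (F w * G w - f' (w (M + 2)) * g' (w (M + 2))) \<le> e" if w: "w \<in> carrier_set" for w
  proof -
    let ?f = "f (w (K + 2))" and ?g = "g (w (L + 2))"
    have F1: "cmod (F w) \<le> 1" and G1: "cmod (G w) \<le> 1"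
      using F G w unfolding odometer_limit_def by auto
    have "cmod ?g \<le> cmod (G w) + cmod (?g - G w)" by (rule norm_triangle_sub)
    also have "\<dots> \<le> 2" using g[OF w] G1 d by (simp add: norm_minus_commute)
    finally have g2: "cmod ?g \<le> 2" .
    have "F w * G w - ?f * ?g = F w * (G w - ?g) + (F w - ?f) * ?g" by (simp add: algebra_simps)
    also have "cmod \<dots> \<le> cmod (F w) * cmod (G w - ?g) + cmod (F w - ?f) * cmod ?g"
      by (metis norm_triangle_ineq norm_mult)
    also have "\<dots> \<le> 1 * d + d * 2"
      using F1 g2 f[OF w] g[OF w] d by (intro add_mono mult_mono) auto
    finally show ?thesis using d(3) f'[OF w] g'[OF w] by simp
  qed
  then show "\<exists>K \<phi>. \<forall>w\<in>carrier_set. cmod (F w * G w - \<phi> (w (K + 2))) \<le> e"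
    by (intro exI[of _ M] exI[of _ "\<lambda>z. f' z * g' z"]) blast
qed

lemma odometer_limit_funpow:
  assumes F: "odometer_limit F"
  shows "odometer_limit (\<lambda>w. F ((twist ^^ n) w))"
  unfolding odometer_limit_def
proof (intro conjI ballI allI impI)
  show "continuous_on carrier_set (\<lambda>w. F ((twist ^^ n) w))"
    using F unfolding odometer_limit_def
    by (auto intro!: continuous_on_compose2[OF _ continuous_on_funpow_twist] funpow_twist_in_carrier)
  show "cmod (F ((twist ^^ n) w)) \<le> 1" if "w \<in> carrier_set" for w
    using F that unfolding odometer_limit_def by (auto simp: funpow_twist_in_carrier)
  fix e :: real assume "0 < e"
  then obtain K f where f: "\<And>w. w \<in> carrier_set \<Longrightarrow> cmod (F w - f (w (K + 2))) \<le> e"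
    using F unfolding odometer_limit_def by meson
  have "cmod (F ((twist ^^ n) w) - f (zeta K ^ n * w (K + 2))) \<le> e" if "w \<in> carrier_set" for w
    using f[OF funpow_twist_in_carrier[OF that, of n]] by (simp add: funpow_twist_ge2)
  then show "\<exists>K \<phi>. \<forall>w\<in>carrier_set. cmod (F ((twist ^^ n) w) - \<phi> (w (K + 2))) \<le> e"
    by (intro exI[of _ K] exI[of _ "\<lambda>z. f (zeta K ^ n * z)"]) blast
qed

lemma odometer_limit_coordinate: 
  assumes "\<And>w. w \<in> carrier_set \<Longrightarrow> cmod (f (w (k + 2))) \<le> 1"
  shows "odometer_limit (\<lambda>w. f (w (k + 2)))"
  unfolding odometer_limit_def
proof (intro conjI ballI allI impI)
  show "\<exists>K \<phi>. \<forall>w\<in>carrier_set. cmod (f (w (k + 2)) - \<phi> (w (K + 2))) \<le> e" if "0 < e" for e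
    using that by (intro exI[of _ k] exI[of _ f]) auto
qed (use assms in \<open>auto intro: continuous_on_odometer_coordinate\<close>)

lemma norm_cis_diff_le: "cmod (cis a - cis b) \<le> \<bar>a - b\<bar>"
proof -
  have "cis a - cis b = cis b * (cis (a - b) - 1)"
    by (simp add: right_diff_distrib cis_mult)
  then have "cmod (cis a - cis b) = cmod (cis (a - b) - 1)" by (simp add: norm_mult)
  also have "\<dots> = 2 * \<bar>sin ((a - b) / 2)\<bar>"
    using dist_exp_i_1[of "a - b"] by (simp add: cis_conv_exp)
  also have "\<dots> \<le> \<bar>a - b\<bar>"
    using abs_sin_x_le_abs_x[of "(a - b) / 2"] by simp
  finally show ?thesis .
qed

text \<open>Truncating the series of \<open>theta\<close> at level \<open>N\<close> leaves a function of the coordinate of level \<open>N\<close>.\<close>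

lemma odometer_limit_cis_theta: "odometer_limit (\<lambda>w. cis (c * theta w))"
  unfolding odometer_limit_def
proof (intro conjI ballI allI impI)
  show "continuous_on carrier_set (\<lambda>w. cis (c * theta w))"
    by (intro continuous_intros continuous_on_theta)
  show "cmod (cis (c * theta w)) \<le> 1" for w by simp
  fix e :: real assume e: "0 < e"
  define d where "d = e / (\<bar>c\<bar> + 1)"
  have d: "0 < d" "\<bar>c\<bar> * d \<le> e" using e by (auto simp: d_def field_simps)
  define s where "s N w = (\<Sum>k<N. bump_at k (zeta k * w (k + 2)) - bump_at k (w (k + 2)))" for N w
  have "\<forall>\<^sub>F N in sequentially. \<forall>w\<in>carrier_set. dist (s N w) (theta w) < d"
    using uniform_limit_theta d(1) unfolding uniform_limit_iff s_def by blast
  from eventually_happens'[OF sequentially_bot this]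
  obtain N where "\<forall>w\<in>carrier_set. dist (s N w) (theta w) < d" ..
  then have N: "\<And>w. w \<in> carrier_set \<Longrightarrow> dist (s N w) (theta w) < d" ..
  define s' where "s' z = (\<Sum>k<N. bump_at k (zeta k * z ^ (period N div period k)) - bump_at k (z ^ (period N div period k)))" for z
  have s': "s' (w (N + 2)) = s N w" if "w \<in> carrier_set" for w
    unfolding s_def s'_def
  proof (rule sum.cong)
    fix k assume "k \<in> {..<N}"
    then have "w (N + 2) ^ (period N div period k) = w (k + 2)"
      using carrier_coordinate_le[OF that, of k N] by simp
    then show "bump_at k (zeta k * w (N + 2) ^ (period N div period k)) - bump_at k (w (N + 2) ^ (period N div period k))
        = bump_at k (zeta k * w (k + 2)) - bump_at k (w (k + 2))" by (simp only:)
  qed simp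
  have "cmod (cis (c * theta w) - cis (c * s' (w (N + 2)))) \<le> e" if w: "w \<in> carrier_set" for w
  proof -
    have "cmod (cis (c * theta w) - cis (c * s N w)) \<le> \<bar>c * theta w - c * s N w\<bar>"
      by (rule norm_cis_diff_le)
    also have "\<dots> = \<bar>c\<bar> * dist (s N w) (theta w)"
      by (simp add: dist_real_def abs_minus_commute flip: abs_mult right_diff_distrib)
    also have "\<dots> \<le> \<bar>c\<bar> * d" using N[OF w] by (intro mult_left_mono) auto
    finally show ?thesis using d(2) s'[OF w] by simp
  qed
  then show "\<exists>K \<phi>. \<forall>w\<in>carrier_set. cmod (cis (c * theta w) - \<phi> (w (K + 2))) \<le> e"
    by (intro exI[of _ N] exI[of _ "\<lambda>z. cis (c * s' z)"]) blast
qed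

definition monomial :: "nat \<Rightarrow> nat \<Rightarrow> int \<Rightarrow> int \<Rightarrow> (nat \<Rightarrow> complex) \<Rightarrow> complex" where
  "monomial k i j l w = w (k + 2) ^ i * w 1 powi j * w 0 powi l"

lemma norm_powi_1: "cmod z = 1 \<Longrightarrow> cmod (z powi n) = 1"
  by (simp add: norm_power_int)

lemma norm_monomial: "w \<in> carrier_set \<Longrightarrow> cmod (monomial k i j l w) = 1"
  by (simp add: monomial_def norm_mult norm_power norm_power_int)

lemma monomial_mult:
  "monomial k i j l (\<lambda>n. v n * w n) = monomial k i j l v * monomial k i j l w"
  by (simp add: monomial_def power_mult_distrib power_int_mult_distrib ac_simps)

lemma continuous_on_powi:
  "continuous_on A f \<Longrightarrow> (\<And>x. x \<in> A \<Longrightarrow> f x \<noteq> 0) \<Longrightarrow>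
     continuous_on A (\<lambda>x. (f x :: complex) powi n)"
  by (intro continuous_intros) auto

lemma continuous_on_monomial: "continuous_on carrier_set (monomial k i j l)"
  unfolding monomial_def
  by (intro continuous_intros continuous_on_coordinate continuous_on_powi) auto

text \<open>After \<open>h\<close> steps the fibre coordinate has collected, up to constants and functions of the
  odometer, the factor \<open>t ^ h\<close>; in a monomial of degree \<open>l\<close> in the fibre this becomes
  \<open>t ^ (l * h)\<close>.\<close>

lemma monomial_funpow_twist:
  "\<exists>\<Psi>. odometer_limit \<Psi> \<and> (\<forall>w\<in>carrier_set.
     monomial k i j l ((twist ^^ h) w) = monomial k i j l w * w 1 powi (l * int h) * \<Psi> w)"
proof (induction h)
  case 0
  have "odometer_limit (\<lambda>w. 1)" using odometer_limit_coordinate[of "\<lambda>_. 1"] by simp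
  then show ?case by (intro exI[of _ "\<lambda>_. 1"]) simp
next
  case (Suc h)
  then obtain \<Psi> where \<Psi>: "odometer_limit \<Psi>" "\<And>w. w \<in> carrier_set \<Longrightarrow>
     monomial k i j l ((twist ^^ h) w) = monomial k i j l w * w 1 powi (l * int h) * \<Psi> w" by blast
  define a where "a = zeta k ^ i * rot powi j * rot powi (l * int h)"
  define c where "c w = cis (of_int l * 2 * pi * theta w)" for w
  define \<Psi>' where "\<Psi>' w = \<Psi> w * (a * c ((twist ^^ h) w))" for w
  have a: "odometer_limit (\<lambda>w. a)"
    using odometer_limit_coordinate[of "\<lambda>_. a" 0]
    by (simp add: a_def norm_mult norm_power norm_power_int)
  have "odometer_limit \<Psi>'"
    unfolding \<Psi>'_def c_def
    by (rule odometer_limit_mult[OF \<Psi>(1) odometer_limit_mult[OF a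
        odometer_limit_funpow[OF odometer_limit_cis_theta]]])
  moreover have "monomial k i j l ((twist ^^ Suc h) w) =
      monomial k i j l w * w 1 powi (l * int (Suc h)) * \<Psi>' w" if w: "w \<in> carrier_set" for w
  proof -
    define v where "v = (twist ^^ h) w"
    have v: "v \<in> carrier_set" using w by (simp add: v_def funpow_twist_in_carrier)
    have v1: "v 1 = rot ^ h * w 1" by (simp add: v_def funpow_twist_1[simplified])
    have "monomial k i j l (twist v) = monomial k i j l v * (zeta k ^ i * rot powi j) * (v 1 powi l * cis (2 * pi * theta v) powi l)"
      by (simp add: monomial_def twist_0 twist_1[simplified] twist_ge2 power_mult_distrib
          power_int_mult_distrib ac_simps)
    also have "cis (2 * pi * theta v) powi l = c v" by (simp add: c_def cis_power_int ac_simps)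
    also have "v 1 powi l = rot powi (l * int h) * w 1 powi l"
      unfolding v1 power_int_mult_distrib mult.commute[of l]
      by (simp only: power_int_mult power_int_of_nat)
    also have "monomial k i j l v = monomial k i j l w * w 1 powi (l * int h) * \<Psi> w"
      unfolding v_def by (rule \<Psi>(2)[OF w])
    finally have "monomial k i j l (twist v) =
        monomial k i j l w * (w 1 powi (l * int h) * w 1 powi l) * \<Psi>' w"
      by (simp add: \<Psi>'_def a_def v_def ac_simps)
    also have "w 1 powi (l * int h) * w 1 powi l = w 1 powi (l * int (Suc h))"
      using w by (simp add: power_int_add[symmetric] distrib_left add.commute)
    finally show ?thesis by (simp add: v_def)
  qed
  ultimately show ?case by blast
qed

section \<open>Trigonometric polynomials determine measures\<close>

abbreviation carrier_top :: "(nat \<Rightarrow> complex) topology" where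
  "carrier_top \<equiv> top_of_set carrier_set"

inductive trig_polynomial :: "((nat \<Rightarrow> complex) \<Rightarrow> complex) \<Rightarrow> bool" where
  base: "trig_polynomial (\<lambda>w. c * monomial k i j l w)"
| add: "trig_polynomial f \<Longrightarrow> trig_polynomial g \<Longrightarrow> trig_polynomial (\<lambda>w. f w + g w)"

text \<open>Products and conjugates of monomials are again monomials only on \<open>carrier_set\<close>, where the
  coordinates are compatible roots of unity; hence equality is only asked for there.\<close>

definition trig_polynomial_on :: "((nat \<Rightarrow> complex) \<Rightarrow> complex) \<Rightarrow> bool" where
  "trig_polynomial_on f \<longleftrightarrow> (\<exists>h. trig_polynomial h \<and> (\<forall>w\<in>carrier_set. f w = h w))"

lemma trig_polynomial_onI: "trig_polynomial h \<Longrightarrow> (\<And>w. w \<in> carrier_set \<Longrightarrow> f w = h w) \<Longrightarrow> trig_polynomial_on f"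
  unfolding trig_polynomial_on_def by blast

lemma trig_polynomial_on_add: "trig_polynomial_on f \<Longrightarrow> trig_polynomial_on g \<Longrightarrow> trig_polynomial_on (\<lambda>w. f w + g w)"
  unfolding trig_polynomial_on_def using trig_polynomial.add by force

lemma trig_polynomial_on_cong: "trig_polynomial_on f \<Longrightarrow> (\<And>w. w \<in> carrier_set \<Longrightarrow> g w = f w) \<Longrightarrow> trig_polynomial_on g"
  unfolding trig_polynomial_on_def by auto

text \<open>For multiplying monomials of different odometer levels.\<close>

lemma monomial_raise:
  assumes "w \<in> carrier_set" "k \<le> K"
  shows "monomial k i j l w = monomial K (period K div period k * i) j l w"
proof -
  have "w (k + 2) = w (K + 2) ^ (period K div period k)" by (rule carrier_coordinate_le[OF assms])
  then show ?thesis unfolding monomial_def power_mult by simp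
qed

lemma monomial_times_monomial:
  assumes w: "w \<in> carrier_set"
  shows "monomial k i j l w * monomial k i' j' l' w = monomial k (i + i') (j + j') (l + l') w"
  using w by (simp add: monomial_def power_add power_int_add ac_simps)

lemma cnj_eq_power:
  assumes "z ^ n = 1" "cmod z = 1" "0 < n"
  shows "cnj z = z ^ (n - 1)"
proof -
  have "z * z ^ (n - 1) = 1" using assms by (metis power_minus_mult mult.commute)
  moreover have "z * cnj z = 1" using assms by (simp add: complex_norm_square[symmetric])
  moreover have "z \<noteq> 0" using assms(2) by force
  ultimately show ?thesis by (metis mult_left_cancel)
qed

lemma cnj_powi:
  assumes "cmod z = 1"
  shows "cnj (z powi n) = z powi (- n)"
proof -
  have "z * cnj z = 1" using assms by (simp add: complex_norm_square[symmetric])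
  then have "cnj z = inverse z" by (metis inverse_unique)
  then show ?thesis by (simp add: power_int_minus power_int_inverse)
qed

lemma cnj_monomial:
  assumes w: "w \<in> carrier_set"
  shows "cnj (monomial k i j l w) = monomial k ((period k - 1) * i) (- j) (- l) w"
proof -
  have "cnj (w (k + 2)) = w (k + 2) ^ (period k - 1)"
    using w by (intro cnj_eq_power carrier_period) auto
  then have "cnj (w (k + 2) ^ i) = w (k + 2) ^ ((period k - 1) * i)"
    by (simp only: complex_cnj_power power_mult)
  then show ?thesis
    unfolding monomial_def complex_cnj_mult using w by (simp only: cnj_powi carrier_norm)
qed

lemma trig_polynomial_on_monomial_mult:
  "trig_polynomial_on (\<lambda>w. (c * monomial k i j l w) * (c' * monomial k' i' j' l' w))"
proof -
  define K where "K = max k k'"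
  have "(c * monomial k i j l w) * (c' * monomial k' i' j' l' w) =
    (c * c') * monomial K (period K div period k * i + period K div period k' * i') (j + j') (l + l') w"
    if w: "w \<in> carrier_set" for w
  proof -
    have "(c * monomial k i j l w) * (c' * monomial k' i' j' l' w) =
      (c * c') * (monomial k i j l w * monomial k' i' j' l' w)" by (simp add: ac_simps)
    also have "monomial k i j l w * monomial k' i' j' l' w =
        monomial K (period K div period k * i) j l w * monomial K (period K div period k' * i') j' l' w"
      by (intro arg_cong2[where f="(*)"] monomial_raise[OF w]) (simp_all add: K_def)
    also note monomial_times_monomial[OF w]
    finally show ?thesis .
  qed
  then show ?thesis by (intro trig_polynomial_onI[OF trig_polynomial.base])
qed

lemma trig_polynomial_on_mult:
  assumes "trig_polynomial_on f" "trig_polynomial_on g"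
  shows "trig_polynomial_on (\<lambda>w. f w * g w)"
proof -
  have 1: "trig_polynomial_on (\<lambda>w. c * monomial k i j l w * g w)" if "trig_polynomial g" for c k i j l g
    using that
  proof induction
    case (base c' k' i' j' l')
    show ?case by (rule trig_polynomial_on_monomial_mult)
  next
    case (add g h)
    then show ?case using trig_polynomial_on_add[OF add.IH] by (simp add: distrib_left)
  qed
  have 2: "trig_polynomial_on (\<lambda>w. f w * g w)" if "trig_polynomial f" "trig_polynomial g" for f g
    using that(1)
  proof induction
    case (base c k i j l)
    then show ?case using 1[OF that(2)] .
  next
    case (add f h)
    then show ?case using trig_polynomial_on_add[OF add.IH] by (simp add: distrib_right)
  qed
  obtain f' g' where "trig_polynomial f'" "trig_polynomial g'" and eq: "\<And>w. w \<in> carrier_set \<Longrightarrow> f w = f' w"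
    "\<And>w. w \<in> carrier_set \<Longrightarrow> g w = g' w" using assms unfolding trig_polynomial_on_def by blast
  from trig_polynomial_on_cong[OF 2[OF this(1,2)]] eq show ?thesis by simp
qed

lemma trig_polynomial_on_cnj:
  assumes "trig_polynomial_on f"
  shows "trig_polynomial_on (\<lambda>w. cnj (f w))"
proof -
  have 1: "trig_polynomial_on (\<lambda>w. cnj (f w))" if "trig_polynomial f" for f
    using that
  proof induction
    case (base c k i j l)
    show ?case
      by (rule trig_polynomial_onI[OF trig_polynomial.base[of "cnj c" k "(period k - 1) * i" "- j" "- l"]])
        (simp add: cnj_monomial)
  next
    case (add f g)
    then show ?case using trig_polynomial_on_add[OF add.IH] by simp
  qed
  obtain f' where "trig_polynomial f'" and eq: "\<And>w. w \<in> carrier_set \<Longrightarrow> f w = f' w"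
    using assms unfolding trig_polynomial_on_def by blast
  from trig_polynomial_on_cong[OF 1[OF this(1)]] eq show ?thesis by simp
qed

lemma trig_polynomial_on_const: "trig_polynomial_on (\<lambda>w. c)"
  by (rule trig_polynomial_onI[OF trig_polynomial.base[of c 0 0 0 0]]) (simp add: monomial_def)

lemma trig_polynomial_on_coordinate: "trig_polynomial_on (\<lambda>w. w i)"
proof (cases i rule: coordinate_cases)
  case 1
  show ?thesis unfolding 1
    by (rule trig_polynomial_onI[OF trig_polynomial.base[of 1 0 0 0 1]]) (simp add: monomial_def)
next
  case 2
  show ?thesis unfolding 2
    by (rule trig_polynomial_onI[OF trig_polynomial.base[of 1 0 0 1 0]]) (simp add: monomial_def)
next
  case (3 k)
  show ?thesis unfolding 3
    by (rule trig_polynomial_onI[OF trig_polynomial.base[of 1 k 1 0 0]]) (simp add: monomial_def)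
qed

lemma continuous_on_trig_on:
  assumes "trig_polynomial_on f"
  shows "continuous_on carrier_set f"
proof -
  have 1: "continuous_on carrier_set f" if "trig_polynomial f" for f
    using that by induction (auto intro!: continuous_intros continuous_on_monomial)
  obtain f' where "trig_polynomial f'" and eq: "\<And>w. w \<in> carrier_set \<Longrightarrow> f w = f' w"
    using assms unfolding trig_polynomial_on_def by blast
  then show ?thesis using 1 continuous_on_cong[of carrier_set carrier_set f f'] by simp
qed

text \<open>The Stone-Weierstrass theorem for the algebra of real parts; it is closed under products
  because \<open>Re a * Re b = Re (a * (b + cnj b) / 2)\<close>, and the coordinates separate points.\<close>

lemma trig_polynomial_on_dense:
  fixes f :: "(nat \<Rightarrow> complex) \<Rightarrow> real"
  assumes f: "continuous_on carrier_set f" and e: "0 < e"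
  obtains g where "trig_polynomial_on g" "\<And>w. w \<in> carrier_set \<Longrightarrow> \<bar>f w - Re (g w)\<bar> < e"
proof -
  define R where "R = {f. \<exists>g. trig_polynomial_on g \<and> f = (\<lambda>w. Re (g w))}"
  have "function_ring_on R carrier_set"
  proof
    show "compact carrier_set" by (rule compact_carrier)
    show "continuous_on carrier_set f" if "f \<in> R" for f
      using that by (auto simp: R_def intro!: continuous_intros continuous_on_trig_on)
    show "(\<lambda>x. f x + g x) \<in> R" if fg: "f \<in> R" "g \<in> R" for f g
    proof -
      obtain f' g' where fg': "trig_polynomial_on f'" "trig_polynomial_on g'" "f = (\<lambda>w. Re (f' w))" "g = (\<lambda>w. Re (g' w))"
        using fg unfolding R_def by blast
      then show ?thesis
        unfolding R_def by (auto intro!: exI[of _ "\<lambda>w. f' w + g' w"] trig_polynomial_on_add)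
    qed
    show "(\<lambda>x. f x * g x) \<in> R" if fg: "f \<in> R" "g \<in> R" for f g
    proof -
      obtain f' g' where fg': "trig_polynomial_on f'" "trig_polynomial_on g'" "f = (\<lambda>w. Re (f' w))" "g = (\<lambda>w. Re (g' w))"
        using fg unfolding R_def by blast
      have "trig_polynomial_on (\<lambda>w. f' w * ((1/2) * (g' w + cnj (g' w))))"
        by (intro trig_polynomial_on_mult trig_polynomial_on_add trig_polynomial_on_cnj trig_polynomial_on_const fg')
      moreover have "Re (f' w) * Re (g' w) = Re (f' w * ((1/2) * (g' w + cnj (g' w))))" for w
        by (simp add: complex_add_cnj)
      ultimately show ?thesis unfolding R_def fg' by blast
    qed
    show "(\<lambda>_. c) \<in> R" for c
      unfolding R_def using trig_polynomial_on_const[of "complex_of_real c"] by fastforce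
    fix v w :: "nat \<Rightarrow> complex" assume "v \<noteq> w"
    then obtain i where "v i \<noteq> w i" by auto
    then have "Re (v i) \<noteq> Re (w i) \<or> Re (- \<i> * v i) \<noteq> Re (- \<i> * w i)"
      by (auto simp: complex_eq_iff)
    moreover have "(\<lambda>w. Re (w i)) \<in> R" unfolding R_def using trig_polynomial_on_coordinate by blast
    moreover have "(\<lambda>w. Re (- \<i> * w i)) \<in> R"
      unfolding R_def using trig_polynomial_on_mult[OF trig_polynomial_on_const[of "-\<i>"] trig_polynomial_on_coordinate[of i]] by blast
    ultimately show "\<exists>f\<in>R. f v \<noteq> f w" by (metis (no_types, lifting))
  qed
  from function_ring_on.Stone_Weierstrass_basic[OF this f e]
  show ?thesis using that by (auto simp: R_def)
qed

locale carrier_measure = prob_space \<mu> for \<mu> :: "(nat \<Rightarrow> complex) measure" +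
  assumes sets_eq: "sets \<mu> = sets (borel_of carrier_top)"
begin

lemma space_eq: "space \<mu> = carrier_set"
  using sets_eq_imp_space_eq[OF sets_eq] by (simp add: space_borel_of)

lemma measurable_continuous:
  assumes f: "continuous_on carrier_set f"
  shows "f \<in> borel_measurable \<mu>"
proof (rule borel_measurableI)
  fix V :: "'a set" assume "open V"
  then have "openin carrier_top (carrier_set \<inter> f -` V)"
    using continuous_openin_preimage_gen[OF f] by blast
  then show "f -` V \<inter> space \<mu> \<in> sets \<mu>"
    using openin_in_borel_of by (simp add: sets_eq space_eq Int_commute)
qed

lemma integrable_continuous:
  fixes f :: "(nat \<Rightarrow> complex) \<Rightarrow> 'b::{banach, second_countable_topology}"
  assumes f: "continuous_on carrier_set f"
  shows "integrable \<mu> f"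
proof -
  have "bounded (f ` carrier_set)"
    by (intro compact_imp_bounded compact_continuous_image f compact_carrier)
  then obtain B where "\<And>w. w \<in> carrier_set \<Longrightarrow> norm (f w) \<le> B"
    unfolding bounded_iff by auto
  then show ?thesis
    by (intro integrable_const_bound[of _ B] measurable_continuous f AE_I2) (simp add: space_eq)
qed

lemma norm_integral_le:
  fixes f :: "(nat \<Rightarrow> complex) \<Rightarrow> 'b::{banach, second_countable_topology}"
  assumes "continuous_on carrier_set f" "\<And>w. w \<in> carrier_set \<Longrightarrow> norm (f w) \<le> B"
  shows "norm (\<integral>w. f w \<partial>\<mu>) \<le> B"
proof -
  have "norm (\<integral>w. f w \<partial>\<mu>) \<le> (\<integral>w. norm (f w) \<partial>\<mu>)" by (rule integral_norm_bound)
  also have "\<dots> \<le> (\<integral>w. B \<partial>\<mu>)"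
    using assms by (intro integral_mono integrable_continuous continuous_intros) (auto simp: space_eq)
  finally show ?thesis by (simp add: prob_space)
qed

end

text \<open>By density the two measures integrate every continuous function equally; the indicator of a
  closed set \<open>K\<close> is the decreasing limit of the continuous functions \<open>max 0 (1 - n * infdist w K)\<close>.\<close>

lemma carrier_measure_eqI:
  assumes M: "carrier_measure \<mu>" and N: "carrier_measure \<nu>"
    and eq: "\<And>k i j l. (\<integral>w. monomial k i j l w \<partial>\<mu>) = (\<integral>w. monomial k i j l w \<partial>\<nu>)"
  shows "\<mu> = \<nu>"
proof -
  interpret M: carrier_measure \<mu> by fact
  interpret N: carrier_measure \<nu> by fact
  have trig_polynomial: "(\<integral>w. f w \<partial>\<mu>) = (\<integral>w. f w \<partial>\<nu>)" if "trig_polynomial f" for f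
    using that
  proof induction
    case (base c k i j l)
    then show ?case by (simp add: eq)
  next
    case (add f g)
    have c: "continuous_on carrier_set f" "continuous_on carrier_set g"
      using add.hyps continuous_on_trig_on trig_polynomial_onI by blast+
    show ?case
      using add.IH by (simp add: M.integrable_continuous N.integrable_continuous c)
  qed
  have trig_polynomial_on: "(\<integral>w. f w \<partial>\<mu>) = (\<integral>w. f w \<partial>\<nu>)" if f: "trig_polynomial_on f" for f
  proof -
    obtain h where h: "trig_polynomial h" "\<And>w. w \<in> carrier_set \<Longrightarrow> f w = h w"
      using f unfolding trig_polynomial_on_def by blast
    have "(\<integral>w. f w \<partial>\<mu>) = (\<integral>w. h w \<partial>\<mu>)" "(\<integral>w. f w \<partial>\<nu>) = (\<integral>w. h w \<partial>\<nu>)"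
      using h(2) by (auto intro!: Bochner_Integration.integral_cong simp: M.space_eq N.space_eq)
    then show ?thesis using trig_polynomial[OF h(1)] by simp
  qed
  have cont: "(\<integral>w. f w \<partial>\<mu>) = (\<integral>w. f w \<partial>\<nu>)" if f: "continuous_on carrier_set f"
    for f :: "(nat \<Rightarrow> complex) \<Rightarrow> real"
  proof -
    have "\<bar>(\<integral>w. f w \<partial>\<mu>) - (\<integral>w. f w \<partial>\<nu>)\<bar> \<le> e" if "0 < e" for e
    proof -
      obtain g where g: "trig_polynomial_on g" "\<And>w. w \<in> carrier_set \<Longrightarrow> \<bar>f w - Re (g w)\<bar> < e / 2"
        using trig_polynomial_on_dense[OF f, of "e/2"] \<open>0 < e\<close> by auto
      have cg: "continuous_on carrier_set g" by (rule continuous_on_trig_on[OF g(1)])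
      then have cr: "continuous_on carrier_set (\<lambda>w. Re (g w))" by (intro continuous_intros)
      have "norm (\<integral>w. f w - Re (g w) \<partial>\<mu>) \<le> e / 2"
        by (rule M.norm_integral_le) (use f cr g(2) in \<open>auto intro!: continuous_intros less_imp_le\<close>)
      moreover have "norm (\<integral>w. f w - Re (g w) \<partial>\<nu>) \<le> e / 2"
        by (rule N.norm_integral_le) (use f cr g(2) in \<open>auto intro!: continuous_intros less_imp_le\<close>)
      moreover have "(\<integral>w. Re (g w) \<partial>\<mu>) = (\<integral>w. Re (g w) \<partial>\<nu>)"
        using trig_polynomial_on[OF g(1)] M.integrable_continuous[OF cg] N.integrable_continuous[OF cg] by simp
      moreover have "(\<integral>w. f w - Re (g w) \<partial>\<mu>) = (\<integral>w. f w \<partial>\<mu>) - (\<integral>w. Re (g w) \<partial>\<mu>)"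
        by (rule Bochner_Integration.integral_diff[OF M.integrable_continuous[OF f] M.integrable_continuous[OF cr]])
      moreover have "(\<integral>w. f w - Re (g w) \<partial>\<nu>) = (\<integral>w. f w \<partial>\<nu>) - (\<integral>w. Re (g w) \<partial>\<nu>)"
        by (rule Bochner_Integration.integral_diff[OF N.integrable_continuous[OF f] N.integrable_continuous[OF cr]])
      ultimately show ?thesis unfolding real_norm_def by argo
    qed
    then have "\<bar>(\<integral>w. f w \<partial>\<mu>) - (\<integral>w. f w \<partial>\<nu>)\<bar> \<le> 0" by (rule field_le_epsilon) simp
    then show ?thesis by simp
  qed
  have lim: "(\<lambda>n. \<integral>w. max 0 (1 - real n * infdist w K) \<partial>\<rho>) \<longlonglongrightarrow> measure \<rho> K"
    if "carrier_measure \<rho>" and K: "closedin carrier_top K" "K \<noteq> {}" for \<rho> K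
  proof -
    interpret carrier_measure \<rho> by fact
    have Kin: "K \<in> sets \<rho>" using K by (simp add: sets_eq closedin_in_borel_of)
    have clK: "closed K" using K(1) closed_carrier closedin_closed_trans by blast
    have c: "continuous_on carrier_set (\<lambda>w. max 0 (1 - real n * infdist w K))" for n
      by (intro continuous_intros)
    have "(\<lambda>n. \<integral>w. max 0 (1 - real n * infdist w K) \<partial>\<rho>) \<longlonglongrightarrow> (\<integral>w. indicator K w \<partial>\<rho>)"
    proof (rule integral_dominated_convergence[where w="\<lambda>_. 1"])
      show "AE w in \<rho>. (\<lambda>n. max 0 (1 - real n * infdist w K)) \<longlonglongrightarrow> indicator K w"
      proof (rule AE_I2)
        fix w
        show "(\<lambda>n. max 0 (1 - real n * infdist w K)) \<longlonglongrightarrow> indicator K w"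
        proof (cases "w \<in> K")
          case True then show ?thesis by simp
        next
          case False
          then have pos: "0 < infdist w K"
            using in_closed_iff_infdist_zero[OF clK K(2)] infdist_nonneg[of w K] by fastforce
          then obtain N where N: "1 < real N * infdist w K" using reals_Archimedean3 by blast
          have "max 0 (1 - real n * infdist w K) = 0" if "N \<le> n" for n
          proof -
            have "real N * infdist w K \<le> real n * infdist w K"
              using that pos by (intro mult_right_mono) auto
            then show ?thesis using N by simp
          qed
          then have "\<forall>\<^sub>F n in sequentially. max 0 (1 - real n * infdist w K) = 0"
            unfolding eventually_sequentially by blast
          then show ?thesis using False by (simp add: tendsto_eventually)
        qed
      qed
      show "AE w in \<rho>. norm (max 0 (1 - real n * infdist w K)) \<le> 1" for n
        by (rule AE_I2) (simp add: infdist_nonneg)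
    qed (use c measurable_continuous Kin in auto)
    then show ?thesis using Kin by simp
  qed
  show ?thesis
  proof (rule measure_eqI_closedin[OF M.sets_eq M.finite_measure N.sets_eq])
    fix K assume K: "closedin carrier_top K"
    show "emeasure \<mu> K = emeasure \<nu> K"
    proof (cases "K = {}")
      case False
      have "(\<integral>w. max 0 (1 - real n * infdist w K) \<partial>\<mu>) = (\<integral>w. max 0 (1 - real n * infdist w K) \<partial>\<nu>)" for n
        by (intro cont continuous_intros)
      then have "measure \<mu> K = measure \<nu> K"
        using lim[OF M K False] lim[OF N K False] LIMSEQ_unique by simp
      then show ?thesis by (simp add: M.emeasure_eq_measure N.emeasure_eq_measure)
    qed simp
  qed
qed

section \<open>Unique ergodicity and full support\<close>

lemma continuous_map_twist: "continuous_map carrier_top carrier_top twist"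
  by (simp add: continuous_on_twist twist_in_carrier)

locale twist_measure = carrier_measure +
  assumes invariant: "distr \<mu> \<mu> twist = \<mu>"
begin

lemma integral_twist:
  fixes f :: "(nat \<Rightarrow> complex) \<Rightarrow> 'b::{banach, second_countable_topology}"
  assumes f: "continuous_on carrier_set f"
  shows "(\<integral>w. f (twist w) \<partial>\<mu>) = (\<integral>w. f w \<partial>\<mu>)"
  using integral_distr[OF measurable_continuous_map[OF continuous_map_twist sets_eq sets_eq]
      measurable_continuous[OF f]]
  by (simp add: invariant)

lemma integral_funpow_twist:
  fixes f :: "(nat \<Rightarrow> complex) \<Rightarrow> 'b::{banach, second_countable_topology}"
  assumes f: "continuous_on carrier_set f"
  shows "(\<integral>w. f ((twist ^^ n) w) \<partial>\<mu>) = (\<integral>w. f w \<partial>\<mu>)"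
proof (induction n)
  case (Suc n)
  have "continuous_on carrier_set (\<lambda>w. f ((twist ^^ n) w))"
    by (rule continuous_on_compose2[OF f continuous_on_funpow_twist])
      (auto simp: funpow_twist_in_carrier)
  from integral_twist[OF this] show ?case by (simp add: Suc funpow_Suc_right del: funpow.simps)
qed simp

text \<open>For a function of the coordinate of level \<open>K\<close>, the iterate \<open>T ^ (period K)\<close> fixes that coordinate
  and multiplies \<open>t ^ j\<close> by a constant different from \<open>1\<close>; an invariant integral must vanish. The
  general case follows by uniform approximation.\<close>

lemma integral_odometer_rot_eq_0:
  assumes \<Phi>: "odometer_limit \<Phi>" and j: "j \<noteq> 0"
  shows "(\<integral>w. w 1 powi j * \<Phi> w \<partial>\<mu>) = 0"
proof -
  have c1: "continuous_on carrier_set (\<lambda>w. w 1 powi j)"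
    by (intro continuous_on_powi continuous_on_coordinate) simp
  have 0: "(\<integral>w. w 1 powi j * \<phi> (w (K + 2)) \<partial>\<mu>) = 0" for \<phi> :: "complex \<Rightarrow> complex" and K
  proof -
    define f where "f w = w 1 powi j * \<phi> (w (K + 2))" for w
    have f: "continuous_on carrier_set f"
      unfolding f_def by (intro continuous_on_mult c1 continuous_on_odometer_coordinate)
    have "f ((twist ^^ period K) w) = rot powi (int (period K) * j) * f w" for w
      unfolding f_def funpow_twist_1 funpow_twist_ge2
      by (simp add: power_int_mult_distrib power_int_mult)
    then have "(\<integral>w. f w \<partial>\<mu>) = rot powi (int (period K) * j) * (\<integral>w. f w \<partial>\<mu>)"
      using integral_funpow_twist[OF f, of "period K"] by simp
    moreover have "rot powi (int (period K) * j) \<noteq> 1"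
      using j by (intro rot_powi_neq_1) (simp add: less_imp_neq[OF period_pos, symmetric])
    ultimately show ?thesis by (simp add: f_def)
  qed
  have "cmod (\<integral>w. w 1 powi j * \<Phi> w \<partial>\<mu>) \<le> 0 + e" if "0 < e" for e
  proof -
    obtain K \<phi> where \<phi>: "\<forall>w\<in>carrier_set. cmod (\<Phi> w - \<phi> (w (K + 2))) \<le> e"
      using \<Phi> \<open>0 < e\<close> unfolding odometer_limit_def by meson
    have c2: "continuous_on carrier_set (\<lambda>w. w 1 powi j * \<Phi> w)"
      using \<Phi> unfolding odometer_limit_def by (intro continuous_on_mult c1) simp
    have c3: "continuous_on carrier_set (\<lambda>w. w 1 powi j * \<phi> (w (K + 2)))"
      by (intro continuous_on_mult c1 continuous_on_odometer_coordinate)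
    have "(\<integral>w. w 1 powi j * \<Phi> w \<partial>\<mu>) = (\<integral>w. w 1 powi j * \<Phi> w \<partial>\<mu>) - (\<integral>w. w 1 powi j * \<phi> (w (K + 2)) \<partial>\<mu>)"
      by (simp only: 0 diff_zero)
    also have "\<dots> = (\<integral>w. w 1 powi j * \<Phi> w - w 1 powi j * \<phi> (w (K + 2)) \<partial>\<mu>)"
      by (rule Bochner_Integration.integral_diff[symmetric,
          OF integrable_continuous[OF c2] integrable_continuous[OF c3]])
    also have "cmod \<dots> \<le> e"
    proof (rule norm_integral_le)
      show "continuous_on carrier_set (\<lambda>w. w 1 powi j * \<Phi> w - w 1 powi j * \<phi> (w (K + 2)))"
        by (intro continuous_on_diff c2 c3)
      fix w assume w: "w \<in> carrier_set"
      have "cmod (w 1 powi j * \<Phi> w - w 1 powi j * \<phi> (w (K + 2))) = cmod (\<Phi> w - \<phi> (w (K + 2)))"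
        unfolding right_diff_distrib[symmetric] norm_mult using w by (simp only: norm_powi_1 carrier_norm mult_1_left)
      then show "cmod (w 1 powi j * \<Phi> w - w 1 powi j * \<phi> (w (K + 2))) \<le> e" using \<phi> w by simp
    qed
    finally show ?thesis by simp
  qed
  then have "cmod (\<integral>w. w 1 powi j * \<Phi> w \<partial>\<mu>) \<le> 0" by (rule field_le_epsilon)
  then show ?thesis by (simp only: norm_le_zero_iff)
qed

text \<open>The orthogonality argument of the van der Corput kind: the functions \<open>F \<circ> T\<^sup>h\<close> are orthonormal, so
  the sum \<open>S N\<close> of \<open>N\<close> of them has norm \<open>sqrt N\<close> in the square mean, whereas its integral is \<open>N\<close>
  times that of \<open>F\<close>.\<close>

lemma integral_monomial_fibre_eq_0:
  assumes l: "l \<noteq> 0"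
  shows "(\<integral>w. monomial k i j l w \<partial>\<mu>) = 0"
proof -
  define F where "F = monomial k i j l"
  define S where "S N w = (\<Sum>h<N. F ((twist ^^ h) w))" for N w
  define I where "I = (\<integral>w. F w \<partial>\<mu>)"
  have cF: "continuous_on carrier_set F" unfolding F_def by (rule continuous_on_monomial)
  have cFh: "continuous_on carrier_set (\<lambda>w. F ((twist ^^ h) w))" for h
    by (rule continuous_on_compose2[OF cF continuous_on_funpow_twist])
      (auto simp: funpow_twist_in_carrier)
  have cS: "continuous_on carrier_set (S N)" for N
    unfolding S_def by (intro continuous_on_sum cFh)
  have cST: "continuous_on carrier_set (\<lambda>w. S N (twist w))" for N
    by (rule continuous_on_compose2[OF cS continuous_on_twist]) (auto simp: twist_in_carrier)
  have corr: "(\<integral>w. F ((twist ^^ Suc h) w) * cnj (F w) \<partial>\<mu>) = 0" for h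
  proof -
    obtain \<Psi> where \<Psi>: "odometer_limit \<Psi>" "\<forall>w\<in>carrier_set. F ((twist ^^ Suc h) w) =
        F w * w 1 powi (l * int (Suc h)) * \<Psi> w"
      using monomial_funpow_twist[of k i j l "Suc h"] unfolding F_def by blast
    have "(\<integral>w. F ((twist ^^ Suc h) w) * cnj (F w) \<partial>\<mu>) = (\<integral>w. w 1 powi (l * int (Suc h)) * \<Psi> w \<partial>\<mu>)"
    proof (rule Bochner_Integration.integral_cong)
      fix w assume "w \<in> space \<mu>"
      then have w: "w \<in> carrier_set" by (simp add: space_eq)
      have "F w * cnj (F w) = 1"
        using norm_monomial[OF w] by (simp add: complex_norm_square[symmetric] F_def)
      moreover have "F ((twist ^^ Suc h) w) * cnj (F w) =
          (F w * cnj (F w)) * (w 1 powi (l * int (Suc h)) * \<Psi> w)"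
        using \<Psi>(2) w by (simp add: ac_simps del: funpow.simps of_nat_Suc)
      ultimately show "F ((twist ^^ Suc h) w) * cnj (F w) = w 1 powi (l * int (Suc h)) * \<Psi> w"
        by simp
    qed simp
    also have "\<dots> = 0" by (rule integral_odometer_rot_eq_0[OF \<Psi>(1)]) (use l in simp)
    finally show ?thesis .
  qed
  have shift: "S (Suc N) w = F w + S N (twist w)" for N w
    unfolding S_def sum.lessThan_Suc_shift by (simp add: funpow_Suc_right del: funpow.simps(2))
  have sq: "(\<integral>w. (cmod (S N w))\<^sup>2 \<partial>\<mu>) = real N" for N
  proof (induction N)
    case 0 then show ?case by (simp add: S_def)
  next
    case (Suc N)
    have c: "continuous_on carrier_set (\<lambda>w. S N (twist w) * cnj (F w))"
      by (intro continuous_on_mult cST continuous_on_cnj cF)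
    have cross: "(\<integral>w. S N (twist w) * cnj (F w) \<partial>\<mu>) = 0"
    proof -
      have "S N (twist w) * cnj (F w) = (\<Sum>h<N. F ((twist ^^ Suc h) w) * cnj (F w))" for w
        by (simp add: S_def sum_distrib_right funpow_Suc_right del: funpow.simps(2))
      moreover have "continuous_on carrier_set (\<lambda>w. F ((twist ^^ Suc h) w) * cnj (F w))" for h
        by (intro continuous_on_mult cFh continuous_on_cnj cF)
      ultimately show ?thesis
        by (simp add: Bochner_Integration.integral_sum integrable_continuous corr del: funpow.simps)
    qed
    have "(\<integral>w. (cmod (S (Suc N) w))\<^sup>2 \<partial>\<mu>) =
        (\<integral>w. (1 + (cmod (S N (twist w)))\<^sup>2) + 2 * Re (S N (twist w) * cnj (F w)) \<partial>\<mu>)"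
    proof (rule Bochner_Integration.integral_cong)
      fix w assume "w \<in> space \<mu>"
      then have "cmod (F w) = 1" using norm_monomial by (simp add: space_eq F_def)
      then have "(Re (F w))\<^sup>2 + (Im (F w))\<^sup>2 = 1" by (simp add: cmod_power2[symmetric])
      then show "(cmod (S (Suc N) w))\<^sup>2 = (1 + (cmod (S N (twist w)))\<^sup>2) + 2 * Re (S N (twist w) * cnj (F w))"
        unfolding shift cmod_power2 by (simp add: power2_eq_square algebra_simps)
    qed simp
    also have "\<dots> = (\<integral>w. 1 + (cmod (S N (twist w)))\<^sup>2 \<partial>\<mu>) + (\<integral>w. 2 * Re (S N (twist w) * cnj (F w)) \<partial>\<mu>)"
      by (intro Bochner_Integration.integral_add integrable_continuous)
        (intro continuous_intros cST c)+
    also have "(\<integral>w. 2 * Re (S N (twist w) * cnj (F w)) \<partial>\<mu>) = 2 * Re (\<integral>w. S N (twist w) * cnj (F w) \<partial>\<mu>)"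
      by (simp only: integral_mult_right_zero integral_Re[OF integrable_continuous[OF c]])
    also have "\<dots> = 0" by (simp only: cross) simp
    also have "(\<integral>w. 1 + (cmod (S N (twist w)))\<^sup>2 \<partial>\<mu>) = (\<integral>w. 1 \<partial>\<mu>) + (\<integral>w. (cmod (S N (twist w)))\<^sup>2 \<partial>\<mu>)"
      by (intro Bochner_Integration.integral_add integrable_continuous)
        (intro continuous_intros cST)+
    also have "(\<integral>w. (cmod (S N (twist w)))\<^sup>2 \<partial>\<mu>) = (\<integral>w. (cmod (S N w))\<^sup>2 \<partial>\<mu>)"
      by (rule integral_twist) (intro continuous_intros cS)
    finally show ?case by (simp add: Suc prob_space)
  qed
  have bound: "real N * cmod I \<le> sqrt (real N)" if N: "0 < N" for N
  proof -
    define r where "r = sqrt (real N)"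
    have r: "0 < r" "r * r = real N" using N by (auto simp: r_def)
    have "(\<integral>w. S N w \<partial>\<mu>) = of_nat N * I"
      unfolding S_def
      by (simp add: Bochner_Integration.integral_sum integrable_continuous cFh
          integral_funpow_twist[OF cF] I_def)
    then have "real N * cmod I = cmod (\<integral>w. S N w \<partial>\<mu>)" by (simp add: norm_mult)
    also have "\<dots> \<le> (\<integral>w. cmod (S N w) \<partial>\<mu>)" by (rule integral_norm_bound)
    also have "\<dots> \<le> (\<integral>w. (cmod (S N w))\<^sup>2 * (1 / (2 * r)) + r / 2 \<partial>\<mu>)"
    proof (rule integral_mono)
      show "integrable \<mu> (\<lambda>w. cmod (S N w))"
        by (intro integrable_continuous continuous_intros cS)
      show "integrable \<mu> (\<lambda>w. (cmod (S N w))\<^sup>2 * (1 / (2 * r)) + r / 2)"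
        by (intro integrable_continuous continuous_intros cS)
      \<comment> \<open>The arithmetic-geometric mean inequality replaces the Cauchy-Schwarz inequality.\<close>
      fix w
      have "0 \<le> (cmod (S N w) - r)\<^sup>2 / (2 * r)" using r by simp
      also have "\<dots> = (cmod (S N w))\<^sup>2 * (1 / (2 * r)) + r / 2 - cmod (S N w)"
        using r by (simp add: power2_eq_square field_simps)
      finally show "cmod (S N w) \<le> (cmod (S N w))\<^sup>2 * (1 / (2 * r)) + r / 2" by simp
    qed
    also have "\<dots> = (\<integral>w. (cmod (S N w))\<^sup>2 * (1 / (2 * r)) \<partial>\<mu>) + (\<integral>w. r / 2 \<partial>\<mu>)"
      by (intro Bochner_Integration.integral_add integrable_continuous)
        (intro continuous_intros cS)+
    also have "\<dots> = real N * (1 / (2 * r)) + r / 2"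
      by (simp only: integral_mult_left_zero sq) (simp add: prob_space)
    also have "\<dots> = r" using r by (simp add: field_simps)
    finally show ?thesis by (simp add: r_def)
  qed
  have "I = 0"
  proof (rule ccontr)
    assume "I \<noteq> 0"
    then have I: "0 < (cmod I)\<^sup>2" by simp
    then obtain N where N: "1 < real N * (cmod I)\<^sup>2" using reals_Archimedean3 by blast
    then have N0: "0 < N" by (cases N) auto
    have "(real N * cmod I)\<^sup>2 \<le> (sqrt (real N))\<^sup>2"
      using bound[OF N0] by (intro power_mono) auto
    then have "real N * (real N * (cmod I)\<^sup>2) \<le> real N * 1"
      by (simp add: power2_eq_square ac_simps)
    then have "real N * (cmod I)\<^sup>2 \<le> 1" using N0 by simp
    then show False using N by simp
  qed
  then show ?thesis by (simp add: I_def F_def)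
qed

lemma integral_monomial_eq_0:
  assumes "l \<noteq> 0 \<or> j \<noteq> 0 \<or> \<not> period k dvd i"
  shows "(\<integral>w. monomial k i j l w \<partial>\<mu>) = 0"
proof (cases "l = 0")
  case False then show ?thesis by (rule integral_monomial_fibre_eq_0)
next
  case l: True
  show ?thesis
  proof (cases "j = 0")
    case False
    have "odometer_limit (\<lambda>w. w (k + 2) ^ i)"
      by (rule odometer_limit_coordinate) (simp add: norm_power)
    from integral_odometer_rot_eq_0[OF this False] show ?thesis
      by (simp add: monomial_def l mult.commute)
  next
    case j: True
    have "monomial k i j l (twist w) = zeta k ^ i * monomial k i j l w" for w
      unfolding monomial_def twist_ge2 by (simp add: l j power_mult_distrib)
    then have "(\<integral>w. monomial k i j l w \<partial>\<mu>) = zeta k ^ i * (\<integral>w. monomial k i j l w \<partial>\<mu>)"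
      using integral_twist[OF continuous_on_monomial, of k i j l] by simp
    moreover have "zeta k ^ i \<noteq> 1" using assms l j by (simp add: zeta_power_eq_1_iff)
    ultimately show ?thesis by simp
  qed
qed

lemma monomial_eq_1:
  assumes "\<not> (l \<noteq> 0 \<or> j \<noteq> 0 \<or> \<not> period k dvd i)" and w: "w \<in> carrier_set"
  shows "monomial k i j l w = 1"
proof -
  obtain n where "i = period k * n" using assms by (auto elim: dvdE)
  then have "w (k + 2) ^ i = 1" by (simp only: power_mult carrier_period[OF w] power_one)
  then show ?thesis using assms by (simp add: monomial_def)
qed

lemma integral_monomial:
  "(\<integral>w. monomial k i j l w \<partial>\<mu>) = (if l \<noteq> 0 \<or> j \<noteq> 0 \<or> \<not> period k dvd i then 0 else 1)"
proof (cases "l \<noteq> 0 \<or> j \<noteq> 0 \<or> \<not> period k dvd i")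
  case True
  then show ?thesis using integral_monomial_eq_0 by presburger
next
  case False
  have "(\<integral>w. monomial k i j l w \<partial>\<mu>) = (\<integral>w. 1 \<partial>\<mu>)"
    using monomial_eq_1[OF False] by (intro Bochner_Integration.integral_cong) (auto simp: space_eq)
  also have "\<dots> = 1" by (simp add: prob_space)
  finally show ?thesis by (simp only: if_not_P[OF False])
qed

text \<open>A nontrivial monomial has integral \<open>0\<close> before and after translation, which multiplies it by a
  constant; so the translated measure has the same monomial integrals.\<close>

lemma translation_invariant:
  assumes v: "v \<in> carrier_set"
  shows "distr \<mu> \<mu> (\<lambda>w i. v i * w i) = \<mu>"
proof -
  let ?t = "\<lambda>w i. v i * w i"
  have "continuous_on carrier_set ?t"
    by (intro continuous_on_coordinatewise_then_product continuous_intros continuous_on_coordinate)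
  then have t: "?t \<in> measurable \<mu> \<mu>"
    by (intro measurable_continuous_map[OF _ sets_eq sets_eq]) (auto simp: mult_in_carrier[OF v])
  interpret D: carrier_measure "distr \<mu> \<mu> ?t"
  proof -
    interpret D: prob_space "distr \<mu> \<mu> ?t" by (rule prob_space_distr[OF t])
    show "carrier_measure (distr \<mu> \<mu> ?t)" by unfold_locales (simp add: sets_eq)
  qed
  show ?thesis
  proof (rule carrier_measure_eqI[OF D.carrier_measure_axioms carrier_measure_axioms])
    fix k i j l
    have "(\<integral>w. monomial k i j l w \<partial>distr \<mu> \<mu> ?t) = (\<integral>w. monomial k i j l (?t w) \<partial>\<mu>)"
      by (rule integral_distr[OF t measurable_continuous[OF continuous_on_monomial]])
    also have "\<dots> = monomial k i j l v * (\<integral>w. monomial k i j l w \<partial>\<mu>)"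
      by (simp add: monomial_mult)
    also have "\<dots> = (\<integral>w. monomial k i j l w \<partial>\<mu>)"
      using monomial_eq_1[OF _ v, of l j k i] by (auto simp: integral_monomial)
    finally show "(\<integral>w. monomial k i j l w \<partial>distr \<mu> \<mu> ?t) = (\<integral>w. monomial k i j l w \<partial>\<mu>)" .
  qed
qed

text \<open>If \<open>U\<close> were null, so would be its translates, and by compactness finitely many of them cover the
  group.\<close>

lemma full_support:
  assumes U: "openin carrier_top U" and u: "u \<in> U"
  shows "measure \<mu> U \<noteq> 0"
proof
  assume 0: "measure \<mu> U = 0"
  define V where "V v = {w\<in>carrier_set. (\<lambda>i. v i * w i) \<in> U}" for v :: "nat \<Rightarrow> complex"
  have V: "openin carrier_top (V v) \<and> emeasure \<mu> (V v) = 0" if v: "v \<in> carrier_set" for v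
  proof -
    let ?t = "\<lambda>w i. v i * w i"
    have "continuous_on carrier_set ?t"
      by (intro continuous_on_coordinatewise_then_product continuous_intros continuous_on_coordinate)
    then have ct: "continuous_map carrier_top carrier_top ?t"
      by (auto simp: mult_in_carrier[OF v])
    then have o: "openin carrier_top (V v)"
      using openin_continuous_map_preimage[OF ct U] by (simp add: V_def)
    have t: "?t \<in> measurable \<mu> \<mu>" by (rule measurable_continuous_map[OF ct sets_eq sets_eq])
    have "emeasure \<mu> U = emeasure (distr \<mu> \<mu> ?t) U" by (simp only: translation_invariant[OF v])
    also have "\<dots> = emeasure \<mu> (V v)"
      using U by (subst emeasure_distr[OF t])
        (auto simp: sets_eq openin_in_borel_of space_eq V_def intro!: arg_cong[where f="emeasure \<mu>"])
    finally show ?thesis using o 0 by (simp add: emeasure_eq_measure)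
  qed
  have uC: "u \<in> carrier_set" using u openin_subset[OF U] by auto
  have cover: "carrier_set \<subseteq> \<Union> (V ` carrier_set)"
  proof
    fix w assume w: "w \<in> carrier_set"
    define v where "v i = u i * cnj (w i)" for i
    have v: "v \<in> carrier_set" unfolding v_def by (rule mult_in_carrier[OF uC cnj_in_carrier[OF w]])
    have "v i * w i = u i" for i
    proof -
      have "cnj (w i) * w i = 1"
        using w by (simp add: mult.commute[of "cnj (w i)"] complex_norm_square[symmetric])
      then show ?thesis by (simp add: v_def mult.assoc)
    qed
    then have "w \<in> V v" using w u by (simp add: V_def)
    then show "w \<in> \<Union> (V ` carrier_set)" using v by blast
  qed
  have "compactin carrier_top carrier_set"
    using compact_carrier by (simp add: compactin_subtopology)
  then obtain \<F> where \<F>: "finite \<F>" "\<F> \<subseteq> V ` carrier_set" "carrier_set \<subseteq> \<Union>\<F>"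
    using cover V unfolding compactin_def by (metis (no_types, lifting) image_iff)
  have "emeasure \<mu> carrier_set \<le> emeasure \<mu> (\<Union>\<F>)"
    using \<F> V by (intro emeasure_mono) (auto simp: sets_eq intro!: sets.finite_Union openin_in_borel_of)
  also have "\<dots> \<le> (\<Sum>X\<in>\<F>. emeasure \<mu> X)"
    using \<F> V emeasure_subadditive_finite[of \<F> "\<lambda>X. X" \<mu>]
    by (auto simp: sets_eq intro!: openin_in_borel_of)
  also have "\<dots> = 0" using \<F> V by (intro sum.neutral) auto
  finally show False using emeasure_space_1 by (simp add: space_eq)
qed

end

lemma twist_measure_unique:
  assumes "twist_measure \<mu>" "twist_measure \<nu>"
  shows "\<mu> = \<nu>"
proof -
  interpret M: twist_measure \<mu> by fact
  interpret N: twist_measure \<nu> by fact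
  show ?thesis
    by (rule carrier_measure_eqI[OF M.carrier_measure_axioms N.carrier_measure_axioms])
      (simp only: M.integral_monomial N.integral_monomial)
qed

lemma twist_measureI:
  assumes "regular_borel_prob carrier_top \<mu>" "distr \<mu> \<mu> twist = \<mu>"
  shows "twist_measure \<mu>"
  using assms unfolding regular_borel_prob_def twist_measure_def carrier_measure_def
    carrier_measure_axioms_def twist_measure_axioms_def by blast

section \<open>Minimality, strict ergodicity and distality\<close>

lemma Hausdorff_carrier: "Hausdorff_space carrier_top"
  by (intro Hausdorff_space_subtopology Hausdorff_space_euclidean)

lemma compact_space_carrier: "compact_space carrier_top"
  using compact_carrier by (intro compact_space_subtopology) simp

lemma flow_twist: "flow carrier_top twist"
  unfolding flow_def
  using compact_space_carrier Hausdorff_carrier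
    continuous_imp_homeomorphic_map[OF continuous_map_twist compact_space_carrier Hausdorff_carrier]
  by (simp add: twist_image twist_inj)

lemma flow_pow_of_nat: "flow_pow X T (int n) = T ^^ n"
  by (simp add: flow_pow_def)

text \<open>Any mean along the orbit gives full mass to every closed set that contains the orbit.\<close>

lemma orbit_measure:
  assumes w: "w \<in> carrier_set"
  obtains \<mu> where "regular_borel_prob carrier_top \<mu>" "distr \<mu> \<mu> twist = \<mu>"
    "\<And>K. closedin carrier_top K \<Longrightarrow> (\<And>n. (twist ^^ n) w \<in> K) \<Longrightarrow> measure \<mu> K = 1"
proof -
  obtain m where m: "invariant_mean m"
    by (rule invariant_mean_of_intervals[OF filterlim_Suc])
  obtain \<mu> where \<mu>: "regular_borel_prob carrier_top \<mu>" "distr \<mu> \<mu> twist = \<mu>"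
    "\<And>K. closedin carrier_top K \<Longrightarrow> m ((\<lambda>n. (twist ^^ n) w) -` K) \<le> measure \<mu> K"
    by (rule invariant_measure_of_orbit_mean[OF compact_space_carrier Hausdorff_carrier m,
          of "\<lambda>n. (twist ^^ n) w" twist])
      (auto simp: funpow_twist_in_carrier w continuous_on_twist twist_in_carrier)
  interpret prob_space \<mu> using \<mu>(1) by (simp add: regular_borel_prob_def)
  have "measure \<mu> K = 1" if K: "closedin carrier_top K" "\<And>n. (twist ^^ n) w \<in> K" for K
  proof -
    have "(\<lambda>n. (twist ^^ n) w) -` K = UNIV" using K(2) by auto
    then have "1 \<le> measure \<mu> K" using \<mu>(3)[OF K(1)] m by (simp add: invariant_mean_def)
    then show ?thesis using prob_le_1[of K] by simp
  qed
  then show ?thesis using that \<mu>(1,2) by blast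
qed

text \<open>The measure supported by the closure of an orbit charges every nonempty open set, so no such
  set misses the orbit.\<close>

lemma minimal_twist: "minimal_flow carrier_top twist"
  unfolding minimal_flow_def
proof
  fix w assume "w \<in> topspace carrier_top"
  then have w: "w \<in> carrier_set" by simp
  define K where "K = carrier_top closure_of range (\<lambda>n. flow_pow carrier_top twist n w)"
  have K: "closedin carrier_top K" unfolding K_def by (rule closedin_closure_of)
  have "(twist ^^ n) w \<in> K" for n
  proof -
    have "(twist ^^ n) w \<in> topspace carrier_top \<inter> range (\<lambda>n. flow_pow carrier_top twist n w)"
      using funpow_twist_in_carrier[OF w] flow_pow_of_nat[of carrier_top twist n] by (auto intro: range_eqI[of _ _ "int n"])
    then show ?thesis unfolding K_def by (rule subsetD[OF closure_of_subset_Int])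
  qed
  note orbit = this
  obtain \<mu> where \<mu>: "regular_borel_prob carrier_top \<mu>" "distr \<mu> \<mu> twist = \<mu>"
    and full: "\<And>K. closedin carrier_top K \<Longrightarrow> (\<And>n. (twist ^^ n) w \<in> K) \<Longrightarrow> measure \<mu> K = 1"
    by (rule orbit_measure[OF w]) blast
  have \<mu>K: "measure \<mu> K = 1" by (rule full[OF K orbit])
  interpret twist_measure \<mu> by (rule twist_measureI[OF \<mu>(1,2)])
  have "carrier_set - K = {}"
  proof (rule ccontr)
    assume "carrier_set - K \<noteq> {}"
    then obtain u where u: "u \<in> carrier_set - K" by blast
    have "openin carrier_top (carrier_set - K)"
      using openin_diff[OF openin_topspace K] by simp
    from full_support[OF this u] have "measure \<mu> (carrier_set - K) \<noteq> 0" .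
    moreover have "K \<in> sets \<mu>" using K by (simp add: sets_eq closedin_in_borel_of)
    ultimately show False using prob_compl[of K] \<mu>K by (simp add: space_eq)
  qed
  then show "K = topspace carrier_top" using closedin_subset[OF K] by auto
qed

lemma strictly_ergodic_twist: "strictly_ergodic carrier_top twist"
  unfolding strictly_ergodic_def
proof (intro conjI minimal_twist ex_ex1I)
  show "\<exists>\<mu>. regular_borel_prob carrier_top \<mu> \<and> distr \<mu> \<mu> twist = \<mu>"
    using orbit_measure[OF one_in_carrier] by blast
  show "\<mu> = \<nu>" if "regular_borel_prob carrier_top \<mu> \<and> distr \<mu> \<mu> twist = \<mu>"
    "regular_borel_prob carrier_top \<nu> \<and> distr \<nu> \<nu> twist = \<nu>" for \<mu> \<nu>
    using twist_measure_unique twist_measureI that by blast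
qed

lemma metrizable_carrier: "metrizable_space carrier_top"
  by (intro metrizable_space_subtopology metrizable_space_euclidean)

text \<open>The condition under which the distance in coordinate \<open>i\<close> is preserved: rotations of the
  coordinates \<open>i > 0\<close> are isometric unconditionally, whereas the fibre coordinate \<open>0\<close> is rotated by
  an angle that depends on the other coordinates.\<close>

definition agree_above :: "nat \<Rightarrow> (nat \<Rightarrow> complex) \<Rightarrow> (nat \<Rightarrow> complex) \<Rightarrow> bool" where
  "agree_above i v w \<longleftrightarrow> i = 0 \<longrightarrow> (\<forall>j>0. v j = w j)"

lemma twist_agree_above:
  assumes v: "v \<in> carrier_set" and w: "w \<in> carrier_set"
  shows "agree_above i (twist v) (twist w) \<longleftrightarrow> agree_above i v w"
    and "agree_above i v w \<Longrightarrow> dist (twist v i) (twist w i) = dist (v i) (w i)"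
proof -
  have "twist v j = twist w j \<longleftrightarrow> v j = w j" if "0 < j" for j
  proof (cases j rule: coordinate_cases)
    case 2
    have "rot \<noteq> 0" by (metis norm_rot norm_zero zero_neq_one)
    then show ?thesis unfolding 2 twist_1 by simp
  next
    case (3 k)
    have "zeta k \<noteq> 0" by (metis norm_zeta norm_zero zero_neq_one)
    then show ?thesis unfolding 3 twist_ge2 by simp
  qed (use that in simp)
  then show "agree_above i (twist v) (twist w) \<longleftrightarrow> agree_above i v w"
    unfolding agree_above_def by auto
  have d: "dist (a * x) (a * y) = dist x y" if "cmod a = 1" for a x y :: complex
    unfolding dist_norm right_diff_distrib[symmetric] norm_mult that by simp
  assume i: "agree_above i v w"
  show "dist (twist v i) (twist w i) = dist (v i) (w i)"
  proof (cases i rule: coordinate_cases)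
    case 1
    have vw: "v j = w j" if "0 < j" for j using i 1 that by (simp add: agree_above_def)
    then have "theta v = theta w" by (intro theta_cong) simp
    then have "twist v 0 = (w 1 * cis (2 * pi * theta w)) * v 0"
      "twist w 0 = (w 1 * cis (2 * pi * theta w)) * w 0"
      using vw[of 1] by (simp_all add: twist_0 ac_simps)
    then show ?thesis unfolding 1 using w by (simp only: d norm_mult carrier_norm norm_cis mult_1)
  next
    case 2 then show ?thesis using d by (simp only: twist_1 norm_rot)
  next
    case (3 k) then show ?thesis using d by (simp only: twist_ge2 norm_zeta)
  qed
qed

lemma flow_pow_agree_above:
  assumes "v \<in> carrier_set" "w \<in> carrier_set" "agree_above i v w"
  shows "dist (flow_pow carrier_top twist n v i) (flow_pow carrier_top twist n w i) = dist (v i) (w i)"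
proof -
  define P where "P v' w' \<longleftrightarrow> v' \<in> carrier_set \<and> w' \<in> carrier_set \<and> agree_above i v' w' \<and>
      dist (v' i) (w' i) = dist (v i) (w i)" for v' w'
  have fwd: "P (twist v') (twist w')" if "P v' w'" for v' w'
    using that twist_agree_above unfolding P_def by (auto simp: twist_in_carrier)
  have bwd: "P (inv_into carrier_set twist v') (inv_into carrier_set twist w')" if P: "P v' w'" for v' w'
  proof -
    define v'' w'' where "v'' = inv_into carrier_set twist v'" and "w'' = inv_into carrier_set twist w'"
    have "v' \<in> twist ` carrier_set" "w' \<in> twist ` carrier_set"
      using P unfolding P_def twist_image by auto
    then have *: "v'' \<in> carrier_set" "twist v'' = v'" "w'' \<in> carrier_set" "twist w'' = w'"
      unfolding v''_def w''_def by (auto simp: inv_into_into f_inv_into_f)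
    have "agree_above i v'' w''"
      using P twist_agree_above(1)[OF *(1,3), of i] unfolding P_def *(2,4) by blast
    moreover have "dist (v'' i) (w'' i) = dist (v' i) (w' i)"
      using twist_agree_above(2)[OF *(1,3) calculation] unfolding *(2,4) by simp
    ultimately have "P v'' w''" using P * unfolding P_def by simp
    then show ?thesis unfolding v''_def w''_def .
  qed
  have 0: "P v w" using assms by (simp add: P_def)
  have f: "P ((twist ^^ k) v) ((twist ^^ k) w)" for k by (induction k) (use 0 fwd in auto)
  have b: "P ((inv_into carrier_set twist ^^ k) v) ((inv_into carrier_set twist ^^ k) w)" for k
    by (induction k) (use 0 bwd in auto)
  have "P (flow_pow carrier_top twist n v) (flow_pow carrier_top twist n w)"
    using f b by (simp add: flow_pow_def)
  then show ?thesis by (simp add: P_def)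
qed

lemma dist_coordinate_le_dist:
  fixes v w :: "'a::countable \<Rightarrow> 'b::metric_space"
  shows "(1/2) ^ to_nat i * min (dist (v i) (w i)) 1 \<le> dist v w"
proof -
  let ?f = "\<lambda>n. (1/2) ^ n * min (dist (v (from_nat n)) (w (from_nat n))) 1"
  have "summable ?f"
    by (rule summable_comparison_test'[of "\<lambda>n. (1/2)^n"]) (auto simp: summable_geometric_iff)
  then have "sum ?f {to_nat i} \<le> suminf ?f" by (intro sum_le_suminf) auto
  then show ?thesis by (simp add: dist_fun_def)
qed

lemma distal_twist: "distal_flow carrier_top twist"
  unfolding distal_flow_def
proof (intro exI[of _ dist] conjI ballI impI)
  interpret Submetric UNIV dist carrier_set by unfold_locales auto
  show "Metric_space (topspace carrier_top) dist"
    using sub.Metric_space_axioms by simp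
  show "Metric_space.mtopology (topspace carrier_top) dist = carrier_top"
    using mtopology_submetric by simp
  fix v w assume "v \<in> topspace carrier_top" "w \<in> topspace carrier_top" and ne: "v \<noteq> w"
  then have vw: "v \<in> carrier_set" "w \<in> carrier_set" by auto
  obtain i where i: "v i \<noteq> w i" "agree_above i v w"
  proof (cases "\<exists>j>0. v j \<noteq> w j")
    case True then show ?thesis using that unfolding agree_above_def by blast
  next
    case False
    then have "v 0 \<noteq> w 0" using ne by (metis ext neq0_conv)
    then show ?thesis using that[of 0] False unfolding agree_above_def by blast
  qed
  define c where "c = (1/2) ^ to_nat i * min (dist (v i) (w i)) 1"
  have "0 < c" using i(1) by (simp add: c_def)
  also have "c \<le> (INF n. dist (flow_pow carrier_top twist n v) (flow_pow carrier_top twist n w))"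
  proof (rule cINF_greatest)
    fix n
    show "c \<le> dist (flow_pow carrier_top twist n v) (flow_pow carrier_top twist n w)"
      using dist_coordinate_le_dist[of i "flow_pow carrier_top twist n v" "flow_pow carrier_top twist n w"]
      unfolding flow_pow_agree_above[OF vw i(2)] c_def .
  qed simp
  finally show "0 < (INF n. dist (flow_pow carrier_top twist n v) (flow_pow carrier_top twist n w))" .
qed

section \<open>Counting visits to the bumps\<close>

text \<open>A block of one period meets each residue class once.\<close>

lemma card_periodic_le:
  fixes Q :: "nat \<Rightarrow> bool"
  assumes P: "0 < P"
  shows "card {n\<in>{A..<A + q * P}. Q ((n + c) mod P)} \<le> q * card {i\<in>{..<P}. Q i}"
proof (induction q)
  case 0 then show ?case by simp
next
  case (Suc q)
  define B where "B = A + q * P"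
  have block: "card {n\<in>{B..<B + P}. Q ((n + c) mod P)} \<le> card {i\<in>{..<P}. Q i}"
  proof (rule card_inj_on_le[where f="\<lambda>n. (n + c) mod P"])
    have le: "n = n'" if "n \<le> n'" "n' < B + P" "B \<le> n" "(n + c) mod P = (n' + c) mod P" for n n'
    proof -
      have "P dvd (n' + c) - (n + c)" using that(1,4) by (subst mod_eq_dvd_iff_nat[symmetric]) auto
      then have "P dvd n' - n" by simp
      moreover have "n' - n < P" using that by linarith
      ultimately have "n' - n = 0" using nat_dvd_not_less by (metis neq0_conv)
      then show ?thesis using that(1) by simp
    qed
    show "inj_on (\<lambda>n. (n + c) mod P) {n\<in>{B..<B + P}. Q ((n + c) mod P)}"
    proof (rule inj_onI)
      fix n n' assume *: "n \<in> {n\<in>{B..<B + P}. Q ((n + c) mod P)}" "n' \<in> {n\<in>{B..<B + P}. Q ((n + c) mod P)}"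
        "(n + c) mod P = (n' + c) mod P"
      show "n = n'"
      proof (cases "n \<le> n'")
        case True then show ?thesis using le[of n n'] * by auto
      next
        case False then show ?thesis using le[of n' n] * by auto
      qed
    qed
  qed (use P in auto)
  have "{n\<in>{A..<A + Suc q * P}. Q ((n + c) mod P)} =
      {n\<in>{A..<A + q * P}. Q ((n + c) mod P)} \<union> {n\<in>{B..<B + P}. Q ((n + c) mod P)}"
    by (auto simp: B_def)
  then have "card {n\<in>{A..<A + Suc q * P}. Q ((n + c) mod P)} \<le>
      card {n\<in>{A..<A + q * P}. Q ((n + c) mod P)} + card {n\<in>{B..<B + P}. Q ((n + c) mod P)}"
    by (simp only: card_Un_le)
  also have "\<dots> \<le> q * card {i\<in>{..<P}. Q i} + card {i\<in>{..<P}. Q i}"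
    by (intro add_mono Suc.IH block)
  finally show ?case by simp
qed

text \<open>The support lies within distance \<open>R = period k / 2 ^ (k + 5)\<close> of a quarter of the period, so it
  has at most \<open>2 * R\<close> elements.\<close>

lemma card_bump_support:
  assumes k: "1 \<le> k"
  shows "card {i\<in>{..<period k}. bump k i \<noteq> 0} * 2 ^ (k + 4) \<le> period k"
proof -
  define R where "R = period k div 2 ^ (k + 5)"
  obtain j where j: "k = Suc j" using k by (cases k) auto
  have "(2::nat) ^ (k + 5) dvd period k"
    unfolding period_def by (intro le_imp_power_dvd) (simp add: j)
  then have R: "period k = 2 ^ (k + 5) * R" by (simp add: R_def)
  have "4 dvd (2::nat) ^ (k + 5)" by (rule dvd_power_le[of 2 2 2 "k+5", simplified])
  then have 4: "4 dvd period k" unfolding R by (rule dvd_mult2)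
  define q where "q = period k div 4"
  have q: "real (period k) / 4 = real q" using 4 by (simp add: q_def real_of_nat_div)
  have "{i\<in>{..<period k}. bump k i \<noteq> 0} \<subseteq> {q - R..<q + R}"
  proof
    fix i assume i: "i \<in> {i\<in>{..<period k}. bump k i \<noteq> 0}"
    then have "i mod period k = i" "bump k i \<noteq> 0" by auto
    then have "\<bar>real i - real q\<bar> * 2 ^ (k + 5) < real (period k)"
      using bump_eq_0[of k i] unfolding q by (metis not_le)
    then have "\<bar>real i - real q\<bar> * 2 ^ (k + 5) < real R * 2 ^ (k + 5)"
      by (simp add: R mult.commute)
    then have "\<bar>real i - real q\<bar> < real R" by (simp only: mult_less_cancel_right_pos zero_less_power zero_less_numeral)
    then show "i \<in> {q - R..<q + R}" by auto
  qed
  then have "card {i\<in>{..<period k}. bump k i \<noteq> 0} \<le> card {q - R..<q + R}" by (intro card_mono) auto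
  also have "\<dots> \<le> 2 * R" by simp
  finally have "card {i\<in>{..<period k}. bump k i \<noteq> 0} * 2 ^ (k + 4) \<le> 2 * R * 2 ^ (k + 4)" by simp
  also have "\<dots> = period k" unfolding R by (simp add: power_add)
  finally show ?thesis .
qed

text \<open>The odometer coordinates of the second point: \<open>shift k\<close> is about half a period at every level,
  so that translating by it moves a bump far away from itself, and compatible with the lower levels.\<close>

fun shift :: "nat \<Rightarrow> nat" where
  "shift 0 = 0"
| "shift (Suc k) = shift k + period (Suc k) div 2"

definition shift_point :: "nat \<Rightarrow> complex" where
  "shift_point i = (if i < 2 then 1 else zeta (i - 2) ^ shift (i - 2))"

definition bump_diff :: "nat \<Rightarrow> nat \<Rightarrow> real" where
  "bump_diff k n = bump k (n + shift k) - bump k n"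

lemma shift_point_ge2: "shift_point (k + 2) = zeta k ^ shift k"
  by (simp add: shift_point_def)

lemma shift_point_in_carrier: "shift_point \<in> carrier_set"
proof (rule carrier_setI)
  show "cmod (shift_point i) = 1" for i by (simp add: shift_point_def norm_power)
  show "shift_point 2 = 1" by (simp add: shift_point_def)
  fix k
  have "period (Suc k) div 2 = period k * 2 ^ (2 * k + 6)"
    by (simp add: period_Suc power_add)
  then have "shift (Suc k) mod period k = shift k mod period k" by simp
  then have "zeta k ^ shift (Suc k) = zeta k ^ shift k" by (simp only: zeta_power_eq_iff)
  moreover have "shift_point (Suc k + 2) ^ (2 ^ (2 * k + 7)) = (zeta (Suc k) ^ (2 ^ (2 * k + 7))) ^ shift (Suc k)"
    unfolding shift_point_ge2 power_mult[symmetric] by (simp only: mult.commute)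
  ultimately show "shift_point (Suc k + 2) ^ (2 ^ (2 * k + 7)) = shift_point (k + 2)"
    unfolding zeta_Suc shift_point_ge2 by (simp only:)
qed

lemma period_Suc_ge: "128 * period k \<le> period (Suc k)"
proof -
  have "(2::nat) ^ 7 \<le> 2 ^ (2 * k + 7)" by (intro power_increasing) auto
  then show ?thesis by (simp add: period_Suc mult.commute)
qed

lemma even_period_Suc: "even (period (Suc k))"
  by (simp add: period_Suc)

lemma shift_less_period: "shift k < period k"
proof (induction k)
  case (Suc k)
  then show ?case using period_Suc_ge[of k] by simp
qed simp

lemma shift_Suc_bounds:
  "2 * shift (Suc k) \<ge> period (Suc k)" "2 * shift (Suc k) \<le> period (Suc k) + 2 * period k"
  using shift_less_period[of k] even_period_Suc[of k] by auto

declare shift.simps [simp del]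

lemma bump_shift_eq_0:
  assumes "8 * n \<le> 3 * period (Suc k)"
  shows "bump (Suc k) (n + shift (Suc k)) = 0"
proof (rule bump_eq_0_outside)
  have "n + shift (Suc k) < period (Suc k)"
    using assms shift_Suc_bounds(2)[of k] period_Suc_ge[of k] period_pos[of "Suc k"] by linarith
  then have "(n + shift (Suc k)) mod period (Suc k) = n + shift (Suc k)" by simp
  moreover have "3 * period (Suc k) \<le> 8 * (n + shift (Suc k))"
    using shift_Suc_bounds(1)[of k] unfolding distrib_left by presburger
  then have "real (3 * period (Suc k)) \<le> real (8 * (n + shift (Suc k)))"
    by (simp only: of_nat_le_iff)
  then have "3 * real (period (Suc k)) \<le> 8 * real (n + shift (Suc k))"
    by (simp only: of_nat_mult of_nat_numeral)
  ultimately show "real ((n + shift (Suc k)) mod period (Suc k)) \<le> real (period (Suc k)) / 8 \<or>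
      3 * real (period (Suc k)) / 8 \<le> real ((n + shift (Suc k)) mod period (Suc k))" by simp
qed

lemma bump_diff_0 [simp]: "bump_diff 0 n = 0"
  unfolding bump_diff_def using bump_level_0[of "n + shift 0"] bump_level_0[of n] by simp

text \<open>Near time \<open>0\<close> neither the bump nor its translate by about half a period has begun.\<close>

lemma bump_diff_eq_0:
  assumes "n \<le> period j" "j < k"
  shows "bump_diff k n = 0"
proof -
  obtain k' where k: "k = Suc k'" using assms by (cases k) auto
  have n: "n \<le> period k'" using assms period_mono[of j k'] k by simp
  have "bump k n = 0"
  proof (rule bump_eq_0_outside)
    have "n < period k" "8 * n \<le> period k"
      using n period_Suc_ge[of k'] period_pos[of k'] unfolding k by linarith+
    then have "n mod period k = n" "8 * real n \<le> real (period k)" by simp_all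
    then show "real (n mod period k) \<le> real (period k) / 8 \<or> 3 * real (period k) / 8 \<le> real (n mod period k)"
      by simp
  qed
  moreover have "bump k (n + shift k) = 0"
    unfolding k by (rule bump_shift_eq_0) (use n period_Suc_ge[of k'] in linarith)
  ultimately show ?thesis by (simp add: bump_diff_def)
qed

text \<open>These times lie on the plateau of the bump, and translating by about half a period leaves its
  support.\<close>

lemma bump_diff_eq_minus_half:
  assumes "period (Suc j) div 4 \<le> n" "n < period (Suc j) div 4 + period j"
  shows "bump_diff (Suc j) n = - 1 / 2"
proof -
  define p where "p = period (Suc j)"
  have p: "p = period j * 2 ^ (2 * j + 7)" "128 * period j \<le> p"
    using period_Suc period_Suc_ge by (auto simp: p_def)
  have "4 dvd (2::nat) ^ (2 * j + 7)" by (rule dvd_power_le[of 2 2 2 "2*j+7", simplified])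
  then have "4 dvd p" unfolding p(1) by (rule dvd_mult)
  then have q: "real p / 4 = real (p div 4)" by (simp add: real_of_nat_div)
  have n: "n < p" using assms p(2) period_pos[of j] unfolding p_def[symmetric] by linarith
  have "bump (Suc j) n = 1 / 2"
  proof (rule bump_eq_half)
    have "\<bar>real n - real p / 4\<bar> \<le> real (period j)"
      using assms unfolding q p_def[symmetric] by linarith
    then have "\<bar>real n - real p / 4\<bar> * 2 ^ (Suc j + 6) \<le> real (period j) * 2 ^ (2 * j + 7)"
      by (intro mult_mono power_increasing) auto
    also have "\<dots> = real p" by (simp add: p(1))
    finally show "\<bar>real (n mod period (Suc j)) - real (period (Suc j)) / 4\<bar> * 2 ^ (Suc j + 6) \<le> real (period (Suc j))"
      using n by (simp add: p_def)
  qed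
  moreover have "bump (Suc j) (n + shift (Suc j)) = 0"
    by (rule bump_shift_eq_0) (use assms p(2) in \<open>unfold p_def[symmetric], linarith\<close>)
  ultimately show ?thesis by (simp add: bump_diff_def)
qed

lemma card_bump_diff_le:
  assumes k: "1 \<le> k" "k \<le> j"
  shows "real (card {n\<in>{A..<A + period j}. bump_diff k n \<noteq> 0}) \<le> real (period j) * (1/2) ^ (k + 3)"
proof -
  obtain q where q: "period j = q * period k" using period_dvd[OF k(2)] by (metis dvdE mult.commute)
  define N where "N = card {i\<in>{..<period k}. bump k i \<noteq> 0}"
  have sub: "{n\<in>{A..<A + period j}. bump_diff k n \<noteq> 0} \<subseteq>
      {n\<in>{A..<A + period j}. bump k ((n + shift k) mod period k) \<noteq> 0} \<union>
      {n\<in>{A..<A + period j}. bump k ((n + 0) mod period k) \<noteq> 0}"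
    by (auto simp: bump_diff_def bump_mod)
  have "card {n\<in>{A..<A + period j}. bump_diff k n \<noteq> 0} \<le>
      card {n\<in>{A..<A + period j}. bump k ((n + shift k) mod period k) \<noteq> 0} +
      card {n\<in>{A..<A + period j}. bump k ((n + 0) mod period k) \<noteq> 0}"
    by (rule order_trans[OF card_mono[OF _ sub] card_Un_le]) simp
  also have "\<dots> \<le> q * N + q * N"
    unfolding q N_def by (intro add_mono card_periodic_le) auto
  finally have "card {n\<in>{A..<A + period j}. bump_diff k n \<noteq> 0} * 2 ^ (k + 3) \<le> (q * N + q * N) * 2 ^ (k + 3)"
    by (rule mult_right_mono) simp
  also have "\<dots> = q * (N * 2 ^ (k + 4))" by (simp add: power_add algebra_simps)
  also have "\<dots> \<le> q * period k"
    unfolding N_def by (intro mult_left_mono card_bump_support k) simp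
  finally have "real (card {n\<in>{A..<A + period j}. bump_diff k n \<noteq> 0} * 2 ^ (k + 3)) \<le> real (period j)"
    unfolding q of_nat_le_iff .
  then show ?thesis by (simp add: power_one_over field_simps)
qed

text \<open>The bad times of level \<open>k\<close> have density at most \<open>(1/2) ^ (k + 3)\<close> in every interval of length
  \<open>period j\<close>, and level \<open>0\<close> contributes none, so the total is below \<open>1/8\<close>.\<close>

lemma card_all_bump_diff_0:
  "7 / 8 * real (period j) \<le> real (card {n\<in>{A..<A + period j}. \<forall>k\<le>j. bump_diff k n = 0})"
proof -
  define G where "G = {n\<in>{A..<A + period j}. \<forall>k\<le>j. bump_diff k n = 0}"
  define B where "B k = {n\<in>{A..<A + period j}. bump_diff k n \<noteq> 0}" for k
  have "{A..<A + period j} \<subseteq> G \<union> (\<Union>k\<in>{1..j}. B k)"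
  proof
    fix n assume n: "n \<in> {A..<A + period j}"
    show "n \<in> G \<union> (\<Union>k\<in>{1..j}. B k)"
    proof (cases "n \<in> G")
      case False
      then obtain k where k: "k \<le> j" "bump_diff k n \<noteq> 0" using n by (auto simp: G_def)
      then have "1 \<le> k" by (cases k) auto
      then show ?thesis using n k by (auto simp: B_def)
    qed simp
  qed
  then have "card {A..<A + period j} \<le> card (G \<union> (\<Union>k\<in>{1..j}. B k))"
    by (intro card_mono) (auto simp: G_def B_def)
  also have "\<dots> \<le> card G + (\<Sum>k\<in>{1..j}. card (B k))"
    by (rule order_trans[OF card_Un_le add_left_mono[OF card_UN_le]]) simp
  finally have "real (period j) \<le> real (card G) + (\<Sum>k\<in>{1..j}. real (card (B k)))"
    by (simp flip: of_nat_sum of_nat_add)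
  also have "(\<Sum>k\<in>{1..j}. real (card (B k))) \<le> (\<Sum>k\<in>{1..j}. real (period j) * (1/2) ^ (k + 3))"
    unfolding B_def by (intro sum_mono card_bump_diff_le) auto
  also have "\<dots> = real (period j) * (\<Sum>k\<in>{1..j}. (1/2) ^ (k + 3))" by (simp only: sum_distrib_left)
  also have "(\<Sum>k\<in>{1..j}. (1/2::real) ^ (k + 3)) = 1/8 - (1/2) ^ (j + 3)"
    by (induction j) (auto simp: power_add eval_nat_numeral)
  also have "real (period j) * (1/8 - (1/2) ^ (j + 3)) \<le> real (period j) * (1/8)"
    by (intro mult_left_mono) auto
  finally show ?thesis unfolding G_def by simp
qed

section \<open>The ratio of two fibre coordinates\<close>

text \<open>The levels above \<open>j\<close> have not yet come into play before time \<open>period j\<close>, which turns the series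
  into a finite sum.\<close>

lemma theta_funpow_diff:
  assumes "Suc n \<le> period j"
  shows "theta ((twist ^^ n) shift_point) - theta ((twist ^^ n) (\<lambda>_. 1)) =
    (\<Sum>k\<le>j. bump_diff k (Suc n) - bump_diff k n)"
proof -
  define v where "v = (twist ^^ n) shift_point"
  define w where "w = (twist ^^ n) (\<lambda>_. 1)"
  define t where "t x k = bump_at k (zeta k * x (k + 2)) - bump_at k (x (k + 2))"
    for x :: "nat \<Rightarrow> complex" and k
  have vw: "v \<in> carrier_set" "w \<in> carrier_set"
    by (simp_all add: v_def w_def funpow_twist_in_carrier shift_point_in_carrier one_in_carrier)
  have tv: "t v k = bump k (Suc n + shift k) - bump k (n + shift k)" for k
  proof -
    have "v (k + 2) = zeta k ^ (n + shift k)"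
      by (simp only: v_def funpow_twist_ge2 shift_point_ge2 power_add)
    then show ?thesis
      using bump_at_zeta_power[of k "n + shift k"] bump_at_zeta_power[of k "Suc (n + shift k)"]
      by (simp add: t_def)
  qed
  have tw: "t w k = bump k (Suc n) - bump k n" for k
  proof -
    have "w (k + 2) = zeta k ^ n" by (simp only: w_def funpow_twist_ge2 mult_1_right)
    then show ?thesis
      using bump_at_zeta_power[of k n] bump_at_zeta_power[of k "Suc n"] by (simp add: t_def)
  qed
  have "theta v - theta w = (\<Sum>k. t v k - t w k)"
    unfolding theta_def t_def by (rule suminf_diff[OF summable_theta[OF vw(1)] summable_theta[OF vw(2)]])
  also have "\<dots> = (\<Sum>k. bump_diff k (Suc n) - bump_diff k n)"
    by (rule suminf_cong) (simp add: tv tw bump_diff_def)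
  also have "\<dots> = (\<Sum>k\<le>j. bump_diff k (Suc n) - bump_diff k n)"
  proof (rule suminf_finite)
    fix k assume "k \<notin> {..j}"
    then show "bump_diff k (Suc n) - bump_diff k n = 0"
      using assms bump_diff_eq_0[of "Suc n" j k] bump_diff_eq_0[of n j k] by simp
  qed simp
  finally show ?thesis by (simp only: v_def w_def)
qed

text \<open>Both points have the same coordinate \<open>1\<close> at all times, so only the values of \<open>theta\<close> contribute
  to the ratio, and their differences telescope.\<close>

lemma funpow_twist_fibre_ratio:
  assumes "n \<le> period j"
  shows "(twist ^^ n) shift_point 0 =
    (twist ^^ n) (\<lambda>_. 1) 0 * cis (2 * pi * (\<Sum>k\<le>j. bump_diff k n))"
  using assms
proof (induction n)
  case 0
  have "bump_diff k 0 = 0" for k by (cases k) (auto intro: bump_diff_eq_0[of 0 0])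
  then show ?case by (simp add: shift_point_def)
next
  case (Suc n)
  define v where "v = (twist ^^ n) shift_point"
  define w where "w = (twist ^^ n) (\<lambda>_. 1)"
  have IH: "v 0 = w 0 * cis (2 * pi * (\<Sum>k\<le>j. bump_diff k n))"
    unfolding v_def w_def by (rule Suc.IH) (use Suc.prems in simp)
  have th: "theta v = theta w + ((\<Sum>k\<le>j. bump_diff k (Suc n)) - (\<Sum>k\<le>j. bump_diff k n))"
    using theta_funpow_diff[OF Suc.prems] unfolding v_def w_def sum_subtractf by linarith
  have "v 1 = w 1" unfolding v_def w_def funpow_twist_1 by (simp add: shift_point_def)
  then have "twist v 0 = w 0 * cis (2 * pi * (\<Sum>k\<le>j. bump_diff k n)) * w 1 * cis (2 * pi * theta v)"
    unfolding twist_0 by (simp only: IH)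
  also have "\<dots> = (w 0 * w 1 * cis (2 * pi * theta w)) * cis (2 * pi * (\<Sum>k\<le>j. bump_diff k (Suc n)))"
    unfolding th by (simp add: cis_mult algebra_simps)
  also have "w 0 * w 1 * cis (2 * pi * theta w) = twist w 0" by (simp only: twist_0)
  finally show ?case by (simp add: v_def w_def)
qed

lemma card_fibre_ratio_1:
  "7 / 8 * real (period j) \<le>
    real (card ({n. (twist ^^ n) shift_point 0 = (twist ^^ n) (\<lambda>_. 1) 0} \<inter> {0..<0 + period j}))"
proof -
  have "{n\<in>{0..<0 + period j}. \<forall>k\<le>j. bump_diff k n = 0} \<subseteq>
    {n. (twist ^^ n) shift_point 0 = (twist ^^ n) (\<lambda>_. 1) 0} \<inter> {0..<0 + period j}"
    using funpow_twist_fibre_ratio[of _ j] by auto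
  then have "card {n\<in>{0..<0 + period j}. \<forall>k\<le>j. bump_diff k n = 0} \<le>
    card ({n. (twist ^^ n) shift_point 0 = (twist ^^ n) (\<lambda>_. 1) 0} \<inter> {0..<0 + period j})"
    by (intro card_mono) auto
  then show ?thesis using card_all_bump_diff_0[of j 0] by linarith
qed

text \<open>At the times of the plateau of level \<open>Suc j\<close> this level contributes \<open>-1/2\<close>, and most of the time
  the lower levels contribute nothing.\<close>

lemma card_fibre_ratio_minus_1:
  "7 / 8 * real (period j) \<le>
    real (card ({n. (twist ^^ n) shift_point 0 = - (twist ^^ n) (\<lambda>_. 1) 0} \<inter>
      {period (Suc j) div 4..<period (Suc j) div 4 + period j}))"
proof -
  let ?I = "{period (Suc j) div 4..<period (Suc j) div 4 + period j}"
  have "{n\<in>?I. \<forall>k\<le>j. bump_diff k n = 0} \<subseteq>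
    {n. (twist ^^ n) shift_point 0 = - (twist ^^ n) (\<lambda>_. 1) 0} \<inter> ?I"
  proof
    fix n assume n: "n \<in> {n\<in>?I. \<forall>k\<le>j. bump_diff k n = 0}"
    then have "(\<Sum>k\<le>Suc j. bump_diff k n) = - 1 / 2"
      using bump_diff_eq_minus_half[of j n] by (simp del: bump_diff_0)
    moreover have "n \<le> period (Suc j)" using n period_Suc_ge[of j] by auto
    moreover have "cis (2 * pi * (- 1 / 2)) = -1" by (simp add: cis.ctr complex_eq_iff)
    ultimately have "(twist ^^ n) shift_point 0 = - (twist ^^ n) (\<lambda>_. 1) 0"
      using funpow_twist_fibre_ratio[of n "Suc j"] by (simp only: mult_minus1_right)
    then show "n \<in> {n. (twist ^^ n) shift_point 0 = - (twist ^^ n) (\<lambda>_. 1) 0} \<inter> ?I"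
      using n by auto
  qed
  then have "card {n\<in>?I. \<forall>k\<le>j. bump_diff k n = 0} \<le>
    card ({n. (twist ^^ n) shift_point 0 = - (twist ^^ n) (\<lambda>_. 1) 0} \<inter> ?I)"
    by (intro card_mono) auto
  then show ?thesis using card_all_bump_diff_0[of j "period (Suc j) div 4"] by linarith
qed

section \<open>Two invariant measures on the enveloping group\<close>

text \<open>The forward orbit of the identity in the enveloping semigroup.\<close>

definition power_map :: "nat \<Rightarrow> (nat \<Rightarrow> complex) \<Rightarrow> nat \<Rightarrow> complex" where
  "power_map n = restrict (twist ^^ n) carrier_set"

lemma enveloping_eq:
  "enveloping carrier_top twist = subtopology (product_topology (\<lambda>_. carrier_top) carrier_set)
     (product_topology (\<lambda>_. carrier_top) carrier_set closure_of
       range (\<lambda>n. restrict (flow_pow carrier_top twist n) carrier_set))"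
  by (simp add: enveloping_def Let_def)

lemma compact_enveloping: "compact_space (enveloping carrier_top twist)"
proof -
  have "compact_space (product_topology (\<lambda>_. carrier_top) carrier_set)"
    by (simp add: compact_space_product_topology compact_space_carrier)
  then show ?thesis
    unfolding enveloping_eq
    by (intro compact_space_subtopology closedin_compact_space closedin_closure_of)
qed

lemma Hausdorff_enveloping: "Hausdorff_space (enveloping carrier_top twist)"
  unfolding enveloping_eq
  by (intro Hausdorff_space_subtopology) (simp add: Hausdorff_space_product_topology Hausdorff_carrier)

lemma flow_pow_in_carrier: "w \<in> carrier_set \<Longrightarrow> flow_pow carrier_top twist n w \<in> carrier_set"
proof -
  assume w: "w \<in> carrier_set"
  have inv: "inv_into carrier_set twist v \<in> carrier_set" if "v \<in> carrier_set" for v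
    using that twist_image by (intro inv_into_into) simp
  have "(inv_into carrier_set twist ^^ k) w \<in> carrier_set" for k
    by (induction k) (auto simp: w inv)
  then show ?thesis using funpow_twist_in_carrier[OF w] by (simp add: flow_pow_def)
qed

lemma twist_flow_pow:
  assumes w: "w \<in> carrier_set"
  shows "twist (flow_pow carrier_top twist n w) = flow_pow carrier_top twist (n + 1) w"
proof (cases "0 \<le> n")
  case True
  then have "nat (n + 1) = Suc (nat n)" by simp
  then show ?thesis using True by (simp add: flow_pow_def)
next
  case False
  define k where "k = nat (- n) - 1"
  have k: "nat (- n) = Suc k" "nat (- (n + 1)) = k" using False by (auto simp: k_def)
  define v where "v = (inv_into carrier_set twist ^^ k) w"
  have "v = flow_pow carrier_top twist (- int k) w" by (cases "k = 0") (auto simp: v_def flow_pow_def)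
  then have "v \<in> twist ` carrier_set" using flow_pow_in_carrier[OF w] twist_image by simp
  then have "twist (inv_into carrier_set twist v) = v" by (rule f_inv_into_f)
  then have "twist (flow_pow carrier_top twist n w) = v"
    using False k by (simp add: flow_pow_def v_def)
  moreover have "flow_pow carrier_top twist (n + 1) w = v"
    using False k by (cases "n + 1 = 0") (auto simp: flow_pow_def v_def)
  ultimately show ?thesis by simp
qed

lemma topspace_enveloping_subset:
  "topspace (enveloping carrier_top twist) \<subseteq> PiE carrier_set (\<lambda>_. carrier_set)"
  unfolding enveloping_eq by auto

lemma power_map_in_enveloping: "power_map n \<in> topspace (enveloping carrier_top twist)"
proof -
  let ?P = "product_topology (\<lambda>_. carrier_top) carrier_set"
  have "power_map n = restrict (flow_pow carrier_top twist (int n)) carrier_set"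
    by (simp only: power_map_def flow_pow_of_nat)
  then have "power_map n \<in> topspace ?P \<inter> range (\<lambda>n. restrict (flow_pow carrier_top twist n) carrier_set)"
    by (auto simp: flow_pow_in_carrier)
  then have "power_map n \<in> ?P closure_of range (\<lambda>n. restrict (flow_pow carrier_top twist n) carrier_set)"
    by (rule subsetD[OF closure_of_subset_Int])
  from IntI[OF subsetD[OF closure_of_subset_topspace this] this] show ?thesis
    unfolding enveloping_eq topspace_subtopology .
qed

lemma enveloping_map_power_map:
  "enveloping_map carrier_top twist (power_map n) = power_map (Suc n)"
  by (auto simp: enveloping_map_def power_map_def compose_def restrict_def)

lemma continuous_map_enveloping_map:
  "continuous_map (enveloping carrier_top twist) (enveloping carrier_top twist)
     (enveloping_map carrier_top twist)"
proof -
  let ?P = "product_topology (\<lambda>_. carrier_top) carrier_set"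
  let ?R = "range (\<lambda>n. restrict (flow_pow carrier_top twist n) carrier_set)"
  let ?f = "enveloping_map carrier_top twist"
  have P: "continuous_map ?P ?P ?f"
    unfolding continuous_map_componentwise
  proof (intro conjI ballI)
    show "?f ` topspace ?P \<subseteq> extensional carrier_set"
      by (auto simp: enveloping_map_def compose_def)
    fix w assume w: "w \<in> carrier_set"
    have "continuous_map ?P carrier_top (\<lambda>p. p w)"
      by (rule continuous_map_product_projection[OF w])
    from continuous_map_compose[OF this continuous_map_twist]
    show "continuous_map ?P carrier_top (\<lambda>p. ?f p w)"
      using w by (simp add: enveloping_map_def compose_def comp_def)
  qed
  have "?f ` ?R \<subseteq> ?R"
  proof
    fix p assume "p \<in> ?f ` ?R"
    then obtain n where "p = ?f (restrict (flow_pow carrier_top twist n) carrier_set)" by blast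
    then have "p = restrict (flow_pow carrier_top twist (n + 1)) carrier_set"
      by (auto simp: enveloping_map_def compose_def restrict_def twist_flow_pow)
    then show "p \<in> ?R" by blast
  qed
  then have "?f ` (?P closure_of ?R) \<subseteq> ?P closure_of ?R"
    by (rule order_trans[OF continuous_map_image_closure_subset[OF P] closure_of_mono])
  then show ?thesis
    unfolding enveloping_eq
    by (intro continuous_map_into_subtopology continuous_map_from_subtopology P) auto
qed

lemma continuous_map_enveloping_coordinate:
  assumes "v \<in> carrier_set"
  shows "continuous_map (enveloping carrier_top twist) euclidean (\<lambda>p. p v i)"
proof -
  have "continuous_map (enveloping carrier_top twist) carrier_top (\<lambda>p. p v)"
    unfolding enveloping_eq
    by (intro continuous_map_from_subtopology continuous_map_product_projection assms)
  moreover have "continuous_map carrier_top euclidean (\<lambda>w. w i)"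
    by (simp add: continuous_on_coordinate)
  ultimately have "continuous_map (enveloping carrier_top twist) euclidean ((\<lambda>w. w i) \<circ> (\<lambda>p. p v))"
    by (rule continuous_map_compose)
  then show ?thesis by (simp add: comp_def)
qed

lemma closedin_enveloping_ratio:
  "closedin (enveloping carrier_top twist)
    {p\<in>topspace (enveloping carrier_top twist). p shift_point 0 = c * p (\<lambda>_. 1) 0}"
proof -
  have "continuous_map (enveloping carrier_top twist) euclidean (\<lambda>p. p shift_point 0 - c * p (\<lambda>_. 1) 0)"
  proof (rule continuous_map_diff)
    show "continuous_map (enveloping carrier_top twist) euclidean (\<lambda>p. p shift_point 0)"
      by (rule continuous_map_enveloping_coordinate[OF shift_point_in_carrier])
    have "continuous_map euclidean euclidean (\<lambda>z. c * z)" by (simp add: continuous_on_mult_left)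
    from continuous_map_compose[OF continuous_map_enveloping_coordinate[OF one_in_carrier] this]
    show "continuous_map (enveloping carrier_top twist) euclidean (\<lambda>p. c * p (\<lambda>_. 1) 0)"
      by (simp add: comp_def)
  qed
  from closedin_continuous_map_preimage[OF this, of "{0}"] show ?thesis by simp
qed

lemma filterlim_period: "filterlim period at_top sequentially"
proof (rule filterlim_at_top_mono[OF filterlim_ident], rule always_eventually, rule allI)
  fix j
  have "j < 2 ^ j" by (rule less_exp)
  also have "(2::nat) ^ j \<le> period j"
    unfolding period_def by (intro power_increasing) auto
  finally show "j \<le> period j" by simp
qed

lemma enveloping_measure:
  fixes a :: "nat \<Rightarrow> nat"
  assumes "\<And>j. 7 / 8 * real (period j) \<le>
    real (card ({n. (twist ^^ n) shift_point 0 = c * (twist ^^ n) (\<lambda>_. 1) 0} \<inter> {a j..<a j + period j}))"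
  obtains \<mu> where "regular_borel_prob (enveloping carrier_top twist) \<mu>"
    "distr \<mu> \<mu> (enveloping_map carrier_top twist) = \<mu>"
    "7 / 8 \<le> measure \<mu> {p\<in>topspace (enveloping carrier_top twist). p shift_point 0 = c * p (\<lambda>_. 1) 0}"
proof -
  let ?K = "{p\<in>topspace (enveloping carrier_top twist). p shift_point 0 = c * p (\<lambda>_. 1) 0}"
  obtain m where m: "invariant_mean m"
    "\<And>A c. (\<And>j. c * real (period j) \<le> real (card (A \<inter> {a j..<a j + period j}))) \<Longrightarrow> c \<le> m A"
    by (rule invariant_mean_of_intervals[OF filterlim_period, of a]) blast
  obtain \<mu> where \<mu>: "regular_borel_prob (enveloping carrier_top twist) \<mu>"
    "distr \<mu> \<mu> (enveloping_map carrier_top twist) = \<mu>"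
    "\<And>K. closedin (enveloping carrier_top twist) K \<Longrightarrow> m (power_map -` K) \<le> measure \<mu> K"
    by (rule invariant_measure_of_orbit_mean[where y=power_map, OF compact_enveloping Hausdorff_enveloping m(1)
          power_map_in_enveloping continuous_map_enveloping_map enveloping_map_power_map]) blast
  have "power_map -` ?K = {n. (twist ^^ n) shift_point 0 = c * (twist ^^ n) (\<lambda>_. 1) 0}"
    using power_map_in_enveloping by (auto simp: power_map_def shift_point_in_carrier one_in_carrier)
  then have "7 / 8 \<le> m (power_map -` ?K)" by (simp only: m(2)[OF assms])
  also have "\<dots> \<le> measure \<mu> ?K" by (rule \<mu>(3)[OF closedin_enveloping_ratio])
  finally show ?thesis using that \<mu>(1,2) by blast
qed

text \<open>The two sets of maps, sending the pair of points to fibre coordinates with ratio \<open>1\<close> and \<open>-1\<close>,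
  are disjoint; a single measure cannot give \<open>7/8\<close> to both.\<close>

lemma not_strictly_ergodic_enveloping:
  "\<not> strictly_ergodic (enveloping carrier_top twist) (enveloping_map carrier_top twist)"
proof
  let ?E = "enveloping carrier_top twist" and ?T = "enveloping_map carrier_top twist"
  let ?K = "\<lambda>c. {p\<in>topspace ?E. p shift_point 0 = c * p (\<lambda>_. 1) 0}"
  assume "strictly_ergodic ?E ?T"
  then have uniq: "\<And>\<mu> \<nu>. regular_borel_prob ?E \<mu> \<Longrightarrow> distr \<mu> \<mu> ?T = \<mu> \<Longrightarrow>
      regular_borel_prob ?E \<nu> \<Longrightarrow> distr \<nu> \<nu> ?T = \<nu> \<Longrightarrow> \<mu> = \<nu>"
    unfolding strictly_ergodic_def by blast
  obtain \<mu> where \<mu>: "regular_borel_prob ?E \<mu>" "distr \<mu> \<mu> ?T = \<mu>" "7 / 8 \<le> measure \<mu> (?K 1)"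
    by (rule enveloping_measure[of 1 "\<lambda>_. 0"]) (use card_fibre_ratio_1 in auto)
  obtain \<nu> where \<nu>: "regular_borel_prob ?E \<nu>" "distr \<nu> \<nu> ?T = \<nu>" "7 / 8 \<le> measure \<nu> (?K (-1))"
    by (rule enveloping_measure[of "-1" "\<lambda>j. period (Suc j) div 4"]) (use card_fibre_ratio_minus_1 in auto)
  have eq: "\<nu> = \<mu>" by (rule uniq[OF \<nu>(1,2) \<mu>(1,2)])
  interpret prob_space \<mu> using \<mu>(1) by (simp add: regular_borel_prob_def)
  have sets: "?K c \<in> sets \<mu>" for c
    using \<mu>(1) closedin_in_borel_of[OF closedin_enveloping_ratio] by (simp add: regular_borel_prob_def)
  have "p (\<lambda>_. 1) 0 \<noteq> 0" if "p \<in> topspace ?E" for p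
  proof -
    have "p \<in> PiE carrier_set (\<lambda>_. carrier_set)" using that topspace_enveloping_subset by blast
    then have "p (\<lambda>_. 1) \<in> carrier_set" using one_in_carrier by (rule PiE_mem)
    then show ?thesis by simp
  qed
  then have "?K 1 \<inter> ?K (-1) = {}" by auto
  then have "measure \<mu> (?K 1 \<union> ?K (-1)) = measure \<mu> (?K 1) + measure \<mu> (?K (-1))"
    by (rule finite_measure_Union[OF sets sets])
  moreover have "measure \<mu> (?K 1 \<union> ?K (-1)) \<le> 1" by (rule prob_le_1)
  ultimately show False using \<mu>(3) \<nu>(3) unfolding eq by linarith
qed

theorem corollary4p2:
  "\<exists>(W :: (nat \<Rightarrow> complex) topology) T.
     flow W T \<and> metrizable_space W \<and> strictly_ergodic W T \<and> distal_flow W T \<and>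
     \<not> strictly_ergodic (enveloping W T) (enveloping_map W T)"
  using flow_twist metrizable_carrier strictly_ergodic_twist distal_twist
    not_strictly_ergodic_enveloping by blast

end
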